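(* Let $p$ be a prime and let $s$ be a generalized $n$-series over a commutative ring $R$ such that: (1) there is a ring endomorphism $\varphi:R\to R$ which sends $s(n)\mapsto\frac{s(np)}{s(p)}$ for all $n$; (2) $s(1)$ is a unit in $R/s(p)$, and $R$ is $s(p)$-adically complete. Define a map $\Phi:s\Omega_{\mathbf{A}^{1,(p)}}\to s\Omega_{\mathbf{A}^1}$ as follows: in degree $0$ it is the map $R[x^p]\to R[x]$ given by $\varphi$ on coefficients and $x^p\mapsto x^p$; in degree $1$ it is the map $R[x^p]\,d(x^p)\to R[x]\,dx$ given by $\varphi$ on coefficients, $x^p\mapsto x^p$, and $d(x^p)\mapsto s(p)x^{p-1}dx$. Then $\Phi$ factors through a quasi-isomorphism $\varphi^*s\Omega_{\mathbf{A}^{1,(p)}}\xrightarrow{\ \sim\ }\eta_{s(p)}s\Omega_{\mathbf{A}^1}$.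
   Context: A generalized $n$-series over $R$ is a function $s:\mathbf{Z}_{\ge 0}\to R$ with $s(0)=0$, $s(n)$ not a zero-divisor for any $n>0$, and $s(n-k)\mid s(n)-s(k)$ for all $n>k>0$; then $s(p)\mid s(np)$ for all $n$. The $s$-de Rham complex of $\mathbf{A}^1=\mathrm{Spec}\,R[x]$ is the two-term complex (degrees $0,1$) $s\Omega_{\mathbf{A}^1}=(R[x]\xrightarrow{\nabla_s}R[x]\,dx)$ with $\nabla_s$ the $R$-linear map $x^n\mapsto s(n)x^{n-1}dx$. For $\mathbf{A}^{1,(p)}=\mathrm{Spec}\,R[x^p]$, $s\Omega_{\mathbf{A}^{1,(p)}}$ is the same complex in the variable $x^p$: $R[x^p]\to R[x^p]\,d(x^p)$, $(x^p)^n\mapsto s(n)(x^p)^{n-1}d(x^p)$. $\varphi^*$ denotes base change along $\varphi$. For a non-zero-divisor $f\in R$ and a termwise $f$-torsionfree complex $M^\bullet$, $\eta_fM^\bullet\subseteq M^\bullet[1/f]$ is the subcomplex $(\eta_fM)^i=\{z\in f^iM^i:dz\in f^{i+1}M^{i+1}\}$. *)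

theory Defs
  imports
    "HOL-Algebra.UnivPoly"
    "HOL-Algebra.QuotRing"
    "HOL-Algebra.Divisibility"
    "HOL-Algebra.Free_Abelian_Groups"
    "HOL-Computational_Algebra.Primes"
begin

section \<open>Rings\<close>

definition non_zero_divisor :: "('a, 'r) ring_scheme \<Rightarrow> 'a \<Rightarrow> bool" where
  "non_zero_divisor R a \<longleftrightarrow>
     a \<in> carrier R \<and> (\<forall>b\<in>carrier R. a \<otimes>\<^bsub>R\<^esub> b = \<zero>\<^bsub>R\<^esub> \<longrightarrow> b = \<zero>\<^bsub>R\<^esub>)"

text \<open>
  The canonical map from \<open>R\<close> to the inverse limit of the quotients \<open>R/(f\<^sup>n)\<close> is bijective (so complete
  includes separated). The transition map of the inverse system sends a coset of \<open>(f\<^sup>n\<^sup>+\<^sup>1)\<close> to the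
  coset of \<open>(f\<^sup>n)\<close> that contains it.
\<close>

definition adically_complete :: "('a, 'r) ring_scheme \<Rightarrow> 'a \<Rightarrow> bool" where
  "adically_complete R f \<longleftrightarrow>
     bij_betw (\<lambda>r n. (PIdl\<^bsub>R\<^esub> (f [^]\<^bsub>R\<^esub> n)) +>\<^bsub>R\<^esub> r) (carrier R)
       {a. (\<forall>n::nat. a n \<in> carrier (R Quot (PIdl\<^bsub>R\<^esub> (f [^]\<^bsub>R\<^esub> n)))) \<and> (\<forall>n. a (Suc n) \<subseteq> a n)}"

definition generalized_n_series :: "('a, 'r) ring_scheme \<Rightarrow> (nat \<Rightarrow> 'a) \<Rightarrow> bool" where
  "generalized_n_series R s \<longleftrightarrow>
     (\<forall>n. s n \<in> carrier R) \<and>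
     s 0 = \<zero>\<^bsub>R\<^esub> \<and>
     (\<forall>n>0. non_zero_divisor R (s n)) \<and>
     (\<forall>n k. 0 < k \<and> k < n \<longrightarrow> s (n - k) divides\<^bsub>R\<^esub> (s n \<ominus>\<^bsub>R\<^esub> s k))"

section \<open>Cochain complexes\<close>

text \<open>For \<open>\<phi>\<close> the identity these are the linear maps.\<close>

definition semilinear_map ::
  "('a, 'r) ring_scheme \<Rightarrow> ('a \<Rightarrow> 'c) \<Rightarrow> ('a, 'b, 'm) module_scheme \<Rightarrow> ('c, 'd, 'n) module_scheme
    \<Rightarrow> ('b \<Rightarrow> 'd) \<Rightarrow> bool" where
  "semilinear_map R \<phi> M N h \<longleftrightarrow>
     h \<in> carrier M \<rightarrow> carrier N \<and>
     (\<forall>x\<in>carrier M. \<forall>y\<in>carrier M. h (x \<oplus>\<^bsub>M\<^esub> y) = h x \<oplus>\<^bsub>N\<^esub> h y) \<and>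
     (\<forall>r\<in>carrier R. \<forall>x\<in>carrier M. h (r \<odot>\<^bsub>M\<^esub> x) = \<phi> r \<odot>\<^bsub>N\<^esub> h x)"

text \<open>Complexes concentrated in degrees \<open>\<ge> 0\<close>.\<close>

record ('a, 'b, 'm) cochain =
  obj :: "nat \<Rightarrow> ('a, 'b, 'm) module_scheme"
  diff :: "nat \<Rightarrow> 'b \<Rightarrow> 'b"

definition cochain_complex :: "('a, 'r) ring_scheme \<Rightarrow> ('a, 'b, 'm) cochain \<Rightarrow> bool" where
  "cochain_complex R C \<longleftrightarrow>
     (\<forall>i. module R (obj C i)) \<and>
     (\<forall>i. semilinear_map R (\<lambda>r. r) (obj C i) (obj C (Suc i)) (diff C i)) \<and>
     (\<forall>i. \<forall>x\<in>carrier (obj C i). diff C (Suc i) (diff C i x) = \<zero>\<^bsub>obj C (Suc (Suc i))\<^esub>)"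

definition semilinear_cochain_map ::
  "('a, 'r) ring_scheme \<Rightarrow> ('c, 's) ring_scheme \<Rightarrow> ('a \<Rightarrow> 'c) \<Rightarrow> ('a, 'b, 'm) cochain
    \<Rightarrow> ('c, 'd, 'n) cochain \<Rightarrow> (nat \<Rightarrow> 'b \<Rightarrow> 'd) \<Rightarrow> bool" where
  "semilinear_cochain_map R S \<phi> C D f \<longleftrightarrow>
     cochain_complex R C \<and> cochain_complex S D \<and>
     (\<forall>i. semilinear_map R \<phi> (obj C i) (obj D i) (f i)) \<and>
     (\<forall>i. \<forall>x\<in>carrier (obj C i). f (Suc i) (diff C i x) = diff D i (f i x))"

abbreviation cochain_map ::
  "('a, 'r) ring_scheme \<Rightarrow> ('a, 'b, 'm) cochain \<Rightarrow> ('a, 'd, 'n) cochain \<Rightarrow> (nat \<Rightarrow> 'b \<Rightarrow> 'd) \<Rightarrow> bool"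
  where "cochain_map R \<equiv> semilinear_cochain_map R R (\<lambda>r. r)"

definition cocycles :: "('a, 'b, 'm) cochain \<Rightarrow> nat \<Rightarrow> 'b set" where
  "cocycles C i = {x \<in> carrier (obj C i). diff C i x = \<zero>\<^bsub>obj C (Suc i)\<^esub>}"

primrec coboundaries :: "('a, 'b, 'm) cochain \<Rightarrow> nat \<Rightarrow> 'b set" where
  "coboundaries C 0 = {\<zero>\<^bsub>obj C 0\<^esub>}"
| "coboundaries C (Suc i) = diff C i ` carrier (obj C i)"

definition cohomology :: "('a, 'b, 'm) cochain \<Rightarrow> nat \<Rightarrow> 'b set monoid" where
  "cohomology C i = add_monoid (obj C i\<lparr>carrier := cocycles C i\<rparr>) Mod coboundaries C i"

text \<open>The union below is the single class of \<open>f i z\<close>, for any representative \<open>z\<close> of \<open>X\<close>.\<close>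

definition cohomology_map ::
  "('c, 'd, 'n) cochain \<Rightarrow> (nat \<Rightarrow> 'b \<Rightarrow> 'd) \<Rightarrow> nat \<Rightarrow> 'b set \<Rightarrow> 'd set" where
  "cohomology_map D f i X = (\<Union>z\<in>X. coboundaries D i +>\<^bsub>obj D i\<^esub> f i z)"

text \<open>
  The map induced on cohomology by a linear cochain map is linear, so being an isomorphism of groups
  is the same as being an isomorphism of modules.
\<close>

definition quasi_isomorphism ::
  "('a, 'r) ring_scheme \<Rightarrow> ('a, 'b, 'm) cochain \<Rightarrow> ('a, 'd, 'n) cochain \<Rightarrow> (nat \<Rightarrow> 'b \<Rightarrow> 'd) \<Rightarrow> bool"
  where
  "quasi_isomorphism R C D f \<longleftrightarrow>
     cochain_map R C D f \<and>
     (\<forall>i. cohomology_map D f i \<in> iso (cohomology C i) (cohomology D i))"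

text \<open>
  Since only degrees \<open>i \<ge> 0\<close> occur and \<open>C\<close> is meant to be termwise \<open>f\<close>-torsionfree, \<open>f\<^sup>i C\<^sup>i\<close> is
  contained in \<open>C\<^sup>i \<subseteq> C\<^sup>i[1/f]\<close> and no localization has to be formed.
\<close>

definition eta :: "('a, 'r) ring_scheme \<Rightarrow> 'a \<Rightarrow> ('a, 'b, 'm) cochain \<Rightarrow> ('a, 'b, 'm) cochain" where
  "eta R f C =
     \<lparr>obj = (\<lambda>i. obj C i\<lparr>carrier :=
        {z. (\<exists>y\<in>carrier (obj C i). z = (f [^]\<^bsub>R\<^esub> i) \<odot>\<^bsub>obj C i\<^esub> y) \<and>
            (\<exists>y\<in>carrier (obj C (Suc i)). diff C i z = (f [^]\<^bsub>R\<^esub> Suc i) \<odot>\<^bsub>obj C (Suc i)\<^esub> y)}\<rparr>),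
      diff = diff C\<rparr>"

section \<open>Base change\<close>

text \<open>
  For a ring homomorphism \<open>\<phi>\<close> from \<open>R\<close> to \<open>S\<close> and an \<open>R\<close>-module \<open>M\<close>, the \<open>S\<close>-module \<open>S \<otimes>\<^sub>R M\<close>, built as
  the free abelian group on pairs \<open>(a, m)\<close> modulo the usual relations.
\<close>

definition tensor_relators ::
  "('a, 'r) ring_scheme \<Rightarrow> ('c, 's) ring_scheme \<Rightarrow> ('a \<Rightarrow> 'c) \<Rightarrow> ('a, 'b, 'm) module_scheme
    \<Rightarrow> ('c \<times> 'b \<Rightarrow>\<^sub>0 int) set" where
  "tensor_relators R S \<phi> M =
     {frag_of (a \<oplus>\<^bsub>S\<^esub> b, m) - frag_of (a, m) - frag_of (b, m) | a b m.
        a \<in> carrier S \<and> b \<in> carrier S \<and> m \<in> carrier M} \<union>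
     {frag_of (a, m \<oplus>\<^bsub>M\<^esub> n) - frag_of (a, m) - frag_of (a, n) | a m n.
        a \<in> carrier S \<and> m \<in> carrier M \<and> n \<in> carrier M} \<union>
     {frag_of (a \<otimes>\<^bsub>S\<^esub> \<phi> r, m) - frag_of (a, r \<odot>\<^bsub>M\<^esub> m) | a r m.
        a \<in> carrier S \<and> r \<in> carrier R \<and> m \<in> carrier M}"

definition tensor_null ::
  "('a, 'r) ring_scheme \<Rightarrow> ('c, 's) ring_scheme \<Rightarrow> ('a \<Rightarrow> 'c) \<Rightarrow> ('a, 'b, 'm) module_scheme
    \<Rightarrow> ('c \<times> 'b \<Rightarrow>\<^sub>0 int) set" where
  "tensor_null R S \<phi> M =
     generate (free_Abelian_group (carrier S \<times> carrier M)) (tensor_relators R S \<phi> M)"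

definition tensor_class ::
  "('a, 'r) ring_scheme \<Rightarrow> ('c, 's) ring_scheme \<Rightarrow> ('a \<Rightarrow> 'c) \<Rightarrow> ('a, 'b, 'm) module_scheme
    \<Rightarrow> ('c \<times> 'b \<Rightarrow>\<^sub>0 int) \<Rightarrow> ('c \<times> 'b \<Rightarrow>\<^sub>0 int) set" where
  "tensor_class R S \<phi> M u =
     tensor_null R S \<phi> M #>\<^bsub>free_Abelian_group (carrier S \<times> carrier M)\<^esub> u"

definition pure_tensor ::
  "('a, 'r) ring_scheme \<Rightarrow> ('c, 's) ring_scheme \<Rightarrow> ('a \<Rightarrow> 'c) \<Rightarrow> ('a, 'b, 'm) module_scheme
    \<Rightarrow> 'c \<Rightarrow> 'b \<Rightarrow> ('c \<times> 'b \<Rightarrow>\<^sub>0 int) set" where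
  "pure_tensor R S \<phi> M a m = tensor_class R S \<phi> M (frag_of (a, m))"

text \<open>
  The scalar \<open>c\<close> acts by \<open>a \<otimes> m \<mapsto> c a \<otimes> m\<close>; the union is a single class, independent of the
  representative. The ring fields \<open>mult\<close> and \<open>one\<close> of the record play no role for modules.
\<close>

definition base_change_module ::
  "('a, 'r) ring_scheme \<Rightarrow> ('c, 's) ring_scheme \<Rightarrow> ('a \<Rightarrow> 'c) \<Rightarrow> ('a, 'b, 'm) module_scheme
    \<Rightarrow> ('c, ('c \<times> 'b \<Rightarrow>\<^sub>0 int) set) module" where
  "base_change_module R S \<phi> M =
     (let Q = free_Abelian_group (carrier S \<times> carrier M) Mod tensor_null R S \<phi> M in
      \<lparr>carrier = carrier Q, monoid.mult = undefined, one = undefined,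
       ring.zero = \<one>\<^bsub>Q\<^esub>, ring.add = monoid.mult Q,
       smult = (\<lambda>c X. \<Union>u\<in>X. tensor_class R S \<phi> M
                  (frag_extend (\<lambda>(a, m). frag_of (c \<otimes>\<^bsub>S\<^esub> a, m)) u))\<rparr>)"

text \<open>The map \<open>a \<otimes> m \<mapsto> a \<otimes> h m\<close> into \<open>S \<otimes>\<^sub>R N\<close>.\<close>

definition base_change_map ::
  "('a, 'r) ring_scheme \<Rightarrow> ('c, 's) ring_scheme \<Rightarrow> ('a \<Rightarrow> 'c) \<Rightarrow> ('a, 'd, 'n) module_scheme
    \<Rightarrow> ('b \<Rightarrow> 'd) \<Rightarrow> ('c \<times> 'b \<Rightarrow>\<^sub>0 int) set \<Rightarrow> ('c \<times> 'd \<Rightarrow>\<^sub>0 int) set" where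
  "base_change_map R S \<phi> N h X =
     (\<Union>u\<in>X. tensor_class R S \<phi> N (frag_extend (\<lambda>(a, m). frag_of (a, h m)) u))"

definition base_change ::
  "('a, 'r) ring_scheme \<Rightarrow> ('c, 's) ring_scheme \<Rightarrow> ('a \<Rightarrow> 'c) \<Rightarrow> ('a, 'b, 'm) cochain
    \<Rightarrow> ('c, ('c \<times> 'b \<Rightarrow>\<^sub>0 int) set, unit) cochain" where
  "base_change R S \<phi> C =
     \<lparr>obj = (\<lambda>i. base_change_module R S \<phi> (obj C i)),
      diff = (\<lambda>i. base_change_map R S \<phi> (obj C (Suc i)) (diff C i))\<rparr>"

section \<open>The s-de Rham complex of the affine line\<close>

text \<open>The term for \<open>n = 0\<close> vanishes because \<open>s 0 = 0\<close>, so the truncated \<open>n - 1\<close> is harmless there.\<close>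

definition nabla :: "('a, 'r) ring_scheme \<Rightarrow> (nat \<Rightarrow> 'a) \<Rightarrow> (nat \<Rightarrow> 'a) \<Rightarrow> (nat \<Rightarrow> 'a)" where
  "nabla R s g =
     (\<Oplus>\<^bsub>UP R\<^esub>n \<in> {..deg R g}. monom (UP R) (s n \<otimes>\<^bsub>R\<^esub> coeff (UP R) g n) (n - 1))"

lemma (in cring) nabla_monom:
  assumes "s \<in> UNIV \<rightarrow> carrier R" and "a \<in> carrier R"
  shows "nabla R s (monom (UP R) a n) = monom (UP R) (s n \<otimes> a) (n - 1)"
proof -
  interpret UP_cring R "UP R" by unfold_locales simp
  have s: "\<And>k. s k \<in> carrier R" using assms(1) by blast
  have A: "n \<in> {..deg R (monom (UP R) a n)}" if "a \<noteq> \<zero>"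
    using that assms by simp
  show ?thesis
  proof (cases "a = \<zero>")
    case True
    have "nabla R s (monom (UP R) a n) = (\<Oplus>\<^bsub>UP R\<^esub>k \<in> {..deg R (monom (UP R) a n)}. \<zero>\<^bsub>UP R\<^esub>)"
      unfolding nabla_def by (rule P.finsum_cong') (auto simp: True s)
    then show ?thesis by (simp add: True s)
  next
    case False
    have "nabla R s (monom (UP R) a n) =
        (\<Oplus>\<^bsub>UP R\<^esub>k \<in> {..deg R (monom (UP R) a n)}.
           if n = k then monom (UP R) (s k \<otimes> a) (k - 1) else \<zero>\<^bsub>UP R\<^esub>)"
      unfolding nabla_def by (rule P.finsum_cong') (auto simp: assms s)
    also have "\<dots> = monom (UP R) (s n \<otimes> a) (n - 1)"
      using A False assms s by (intro P.finsum_singleton) auto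
    finally show ?thesis .
  qed
qed

text \<open>
  The polynomial \<open>g\<close> in degree 1 stands for the form \<open>g dx\<close>. The name of the variable is immaterial, so
  the same object also serves as the complex of \<open>Spec R[x\<^sup>p]\<close>: there the variable of \<open>UP R\<close> stands
  for \<open>x\<^sup>p\<close>, and \<open>g\<close> in degree 1 for \<open>g d(x\<^sup>p)\<close>.
\<close>

definition s_deRham ::
  "('a, 'r) ring_scheme \<Rightarrow> (nat \<Rightarrow> 'a)
    \<Rightarrow> ('a, nat \<Rightarrow> 'a, \<lparr>monom :: 'a \<Rightarrow> nat \<Rightarrow> nat \<Rightarrow> 'a, coeff :: (nat \<Rightarrow> 'a) \<Rightarrow> nat \<Rightarrow> 'a\<rparr>) cochain"
  where
  "s_deRham R s =
     \<lparr>obj = (\<lambda>i. if i \<le> 1 then UP R else UP R\<lparr>carrier := {\<zero>\<^bsub>UP R\<^esub>}\<rparr>),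
      diff = (\<lambda>i. if i = 0 then nabla R s else (\<lambda>_. \<zero>\<^bsub>UP R\<^esub>))\<rparr>"

text \<open>
  With \<open>y = x\<^sup>p\<close> the variable of the source: \<open>frob_subst\<close> applies \<open>\<phi>\<close> to the coefficients and substitutes
  \<open>y \<mapsto> x\<^sup>p\<close>, and \<open>dy\<close> goes to \<open>s(p) x\<^sup>p\<^sup>-\<^sup>1 dx\<close>.
\<close>

definition frob_subst ::
  "('a, 'r) ring_scheme \<Rightarrow> ('a \<Rightarrow> 'a) \<Rightarrow> nat \<Rightarrow> (nat \<Rightarrow> 'a) \<Rightarrow> (nat \<Rightarrow> 'a)" where
  "frob_subst R \<phi> p = eval R (UP R) (\<lambda>r. monom (UP R) (\<phi> r) 0) (monom (UP R) \<one>\<^bsub>R\<^esub> p)"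

lemma (in cring) frob_subst_monom:
  assumes "\<phi> \<in> ring_hom R R" and "a \<in> carrier R"
  shows "frob_subst R \<phi> p (monom (UP R) a n) = monom (UP R) (\<phi> a) (p * n)"
proof -
  have R: "cring R" by unfold_locales
  interpret UP_cring R "UP R" by unfold_locales simp
  have pa: "\<phi> a \<in> carrier R" using assms by (simp add: ring_hom_closed)
  have h: "(\<lambda>r. monom (UP R) (\<phi> r) 0) \<in> ring_hom R (UP R)"
    using ring_hom_trans[OF assms(1) const_ring_hom] unfolding comp_def .
  have E: "UP_pre_univ_prop R (UP R) (\<lambda>r. monom (UP R) (\<phi> r) 0)"
    by (intro UP_pre_univ_prop.intro ring_hom_cring.intro ring_hom_cring_axioms.intro UP_cring.intro
        h R UP_cring)
  have "frob_subst R \<phi> p (monom (UP R) a n) =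
      monom (UP R) (\<phi> a) 0 \<otimes>\<^bsub>UP R\<^esub> monom (UP R) \<one> p [^]\<^bsub>UP R\<^esub> n"
    unfolding frob_subst_def using assms(2) UP_one_closed by (intro UP_pre_univ_prop.eval_monom[OF E]) simp_all
  also have "monom (UP R) \<one> p [^]\<^bsub>UP R\<^esub> n = monom (UP R) \<one> (p * n)"
    by (simp add: monom_pow)
  also have "monom (UP R) (\<phi> a) 0 \<otimes>\<^bsub>UP R\<^esub> monom (UP R) \<one> (p * n) = monom (UP R) (\<phi> a) (p * n)"
    using monom_mult[of "\<phi> a" \<one> 0 "p * n"] pa by simp
  finally show ?thesis .
qed

definition Phi ::
  "('a, 'r) ring_scheme \<Rightarrow> (nat \<Rightarrow> 'a) \<Rightarrow> ('a \<Rightarrow> 'a) \<Rightarrow> nat \<Rightarrow> nat \<Rightarrow> (nat \<Rightarrow> 'a) \<Rightarrow> (nat \<Rightarrow> 'a)" where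
  "Phi R s \<phi> p i =
     (if i = 0 then frob_subst R \<phi> p
      else if i = 1 then (\<lambda>g. frob_subst R \<phi> p g \<otimes>\<^bsub>UP R\<^esub> monom (UP R) (s p) (p - 1))
      else (\<lambda>_. \<zero>\<^bsub>UP R\<^esub>))"

end

theory Submission
  imports Defs
begin

text \<open>
  Give \<open>x\<^sup>n\<close> and \<open>x\<^sup>n\<^sup>-\<^sup>1 dx\<close> the weight \<open>n\<close>. The differential multiplies by \<open>s(n)\<close> in weight \<open>n\<close>, so the complex
  \<open>\<eta>\<close> splits by weight. If \<open>p\<close> divides \<open>n > 0\<close>, then \<open>s(p)\<close> divides \<open>s(n)\<close>, and weight \<open>n\<close> of \<open>\<eta>\<close> is
  \<open>R \<rightarrow> s(p) R\<close>, because the condition on the differential is automatic. If \<open>p\<close> does not divide \<open>n\<close>, then \<open>s(n)\<close> is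
  a unit and weight \<open>n\<close> is \<open>s(p) R \<rightarrow> s(p) R\<close>, which is acyclic. Weight \<open>0\<close> is \<open>R\<close> in degree 0.

  The base change of the source along \<open>\<phi>\<close> is again free on the powers of \<open>y = x\<^sup>p\<close>, and the linear
  extension \<open>\<Psi>\<close> of \<open>\<Phi>\<close> sends \<open>y\<^sup>k\<close> to \<open>x\<^sup>p\<^sup>k\<close> and \<open>y\<^sup>k\<^sup>-\<^sup>1 dy\<close> to \<open>s(p) x\<^sup>p\<^sup>k\<^sup>-\<^sup>1 dx\<close>. It is therefore an
  isomorphism onto the part of \<open>\<eta>\<close> in weights divisible by \<open>p\<close>, and the remaining part is acyclic. It is a
  cochain map because \<open>s(p) \<phi>(s(k)) = s(p k)\<close>.

  That \<open>s(n)\<close> is a unit for \<open>n\<close> prime to \<open>p\<close> is \<open>s_Units_of_coprime\<close>: the divisibilities between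
  differences show that \<open>s(n)\<close> divides \<open>s(1)\<close> modulo \<open>s(p)\<close>, and units modulo \<open>s(p)\<close> lift to units by
  completeness. The splitting enters through the criterion \<open>quasi_isomorphismI\<close>, whose two
  hypotheses are checked by comparing coefficients. The linear extension exists by the universal property
  \<open>semilinear_cochain_map_lift\<close>, and \<open>tensor_expansion\<close> reduces elements of the tensor product to
  finitely many coefficients.
\<close>

section \<open>Units in adically complete rings\<close>

lemma (in cring) mem_principal_coset_iff:
  "y \<in> PIdl c +> r \<longleftrightarrow> (\<exists>x\<in>carrier R. y = x \<otimes> c \<oplus> r)"
  unfolding a_r_coset_def' cgenideal_def by auto

lemma (in cring) principal_coset_cong:
  assumes "c \<in> carrier R" "b \<in> carrier R" "x \<in> carrier R" "a = x \<otimes> c \<oplus> b"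
  shows "PIdl c +> a = PIdl c +> b"
proof -
  have a: "a \<in> carrier R" using assms by simp
  have "a \<ominus> b = x \<otimes> c" using assms by algebra
  then have "a \<ominus> b \<in> PIdl c" using assms(3) unfolding cgenideal_def by auto
  then show ?thesis
    using quotient_eq_iff_same_a_r_cos[OF cgenideal_ideal[OF assms(1)] a assms(2)] by simp
qed

lemma (in cring) unit_mod_principal_imp_comaximal:
  assumes c: "c \<in> carrier R" and a: "a \<in> carrier R"
    and u: "PIdl c +> a \<in> Units (R Quot (PIdl c))"
  obtains v t where "v \<in> carrier R" "t \<in> carrier R" "a \<otimes> v \<oplus> c \<otimes> t = \<one>"
proof -
  interpret I: ideal "PIdl c" R by (rule cgenideal_ideal[OF c])
  obtain Y where Y: "Y \<in> carrier (R Quot (PIdl c))"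
      "(PIdl c +> a) \<otimes>\<^bsub>R Quot (PIdl c)\<^esub> Y = \<one>\<^bsub>R Quot (PIdl c)\<^esub>"
    using u unfolding Units_def by auto
  obtain v where v: "v \<in> carrier R" "Y = PIdl c +> v"
    using Y(1) by (auto simp: FactRing_simps)
  have "PIdl c +> (a \<otimes> v) = PIdl c +> \<one>"
    using Y(2) a v by (simp add: FactRing_def I.rcoset_mult_add)
  moreover have "\<one> \<in> PIdl c +> \<one>"
    using c by (auto simp: mem_principal_coset_iff intro!: bexI[of _ \<zero>])
  ultimately obtain t where t: "t \<in> carrier R" "\<one> = t \<otimes> c \<oplus> a \<otimes> v"
    by (metis mem_principal_coset_iff)
  have "a \<otimes> v \<oplus> c \<otimes> t = \<one>"
    by (subst t(2), use t(1) a v(1) c in algebra)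
  with v t show ?thesis using that by blast
qed

text \<open>
  Here \<open>a v = 1 - f t\<close>, and the geometric series \<open>1 + f t + (f t)\<^sup>2 + \<dots>\<close> converges in an \<open>f\<close>-adically
  complete ring: its partial sums form an element of the inverse limit, and the limit is an inverse of
  \<open>a v\<close> because it is one modulo every power of \<open>f\<close>.
\<close>

lemma (in cring) adically_complete_comaximal_imp_Units:
  assumes complete: "adically_complete R f" and f: "f \<in> carrier R"
    and a: "a \<in> carrier R" and v: "v \<in> carrier R" and t: "t \<in> carrier R"
    and comax: "a \<otimes> v \<oplus> f \<otimes> t = \<one>"
  shows "a \<in> Units R"
proof -
  define S where "S = rec_nat \<zero> (\<lambda>n x. x \<oplus> (f \<otimes> t) [^] n)"
  have S_0: "S 0 = \<zero>" and S_Suc: "\<And>n. S (Suc n) = S n \<oplus> (f \<otimes> t) [^] n"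
    by (simp_all add: S_def)
  have S: "S n \<in> carrier R" for n
    by (induction n) (simp_all add: S_0 S_Suc f t)
  let ?u = "a \<otimes> v"
  have u: "?u \<in> carrier R" "?u = \<one> \<ominus> f \<otimes> t"
    subgoal using a v by simp
    subgoal unfolding comax[symmetric] using a v f t by algebra
    done
  have geom: "?u \<otimes> S n = \<one> \<ominus> (f \<otimes> t) [^] n" for n
  proof (induction n)
    case 0 show ?case using u(1) by (simp add: S_0 a_minus_def r_neg)
  next
    case (Suc n)
    have p: "(f \<otimes> t) [^] n \<in> carrier R" using f t by simp
    have "?u \<otimes> S (Suc n) = ?u \<otimes> S n \<oplus> ?u \<otimes> (f \<otimes> t) [^] n"
      using u(1) S p by (simp add: S_Suc r_distr)
    also have "\<dots> = (\<one> \<ominus> (f \<otimes> t) [^] n) \<oplus> (\<one> \<ominus> f \<otimes> t) \<otimes> (f \<otimes> t) [^] n"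
      by (simp only: Suc u(2)[symmetric])
    also have "\<dots> = \<one> \<ominus> (f \<otimes> t) [^] n \<otimes> (f \<otimes> t)" using p f t by algebra
    finally show ?case by simp
  qed
  let ?A = "{g. (\<forall>n::nat. g n \<in> carrier (R Quot (PIdl (f [^] n)))) \<and> (\<forall>n. g (Suc n) \<subseteq> g n)}"
  let ?\<iota> = "\<lambda>r n. PIdl (f [^] (n::nat)) +> r"
  have bij: "bij_betw ?\<iota> (carrier R) ?A"
    using complete unfolding adically_complete_def .
  \<comment> \<open>Surjectivity of the completion map turns the partial sums into an element of the ring.\<close>
  have "(\<lambda>n. PIdl (f [^] n) +> S n) \<in> ?A"
  proof (intro CollectI conjI allI)
    fix n :: nat
    show "PIdl (f [^] n) +> S n \<in> carrier (R Quot (PIdl (f [^] n)))"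
      using S by (auto simp: FactRing_simps)
    show "PIdl (f [^] Suc n) +> S (Suc n) \<subseteq> PIdl (f [^] n) +> S n"
    proof
      fix y assume "y \<in> PIdl (f [^] Suc n) +> S (Suc n)"
      then obtain x where x: "x \<in> carrier R" "y = x \<otimes> f [^] Suc n \<oplus> S (Suc n)"
        by (auto simp: mem_principal_coset_iff)
      have pp: "f [^] n \<in> carrier R" "t [^] n \<in> carrier R" using f t by simp_all
      have "y = x \<otimes> (f [^] n \<otimes> f) \<oplus> (S n \<oplus> f [^] n \<otimes> t [^] n)"
        using x f t by (simp add: S_Suc nat_pow_distrib)
      also have "\<dots> = (x \<otimes> f \<oplus> t [^] n) \<otimes> f [^] n \<oplus> S n"
        using x(1) f pp S[of n] by algebra
      finally show "y \<in> PIdl (f [^] n) +> S n"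
        using x(1) f pp by (auto simp: mem_principal_coset_iff)
    qed
  qed
  then obtain r where r: "r \<in> carrier R" "?\<iota> r = (\<lambda>n. PIdl (f [^] n) +> S n)"
    using bij unfolding bij_betw_def by (metis (no_types, lifting) imageE)
  \<comment> \<open>Injectivity: it is enough to compare the two sides modulo every power of \<open>f\<close>.\<close>
  have "?\<iota> (?u \<otimes> r) = ?\<iota> \<one>"
  proof
    fix n :: nat
    have fn: "f [^] n \<in> carrier R" using f by simp
    have tn: "t [^] n \<in> carrier R" using t by simp
    have "S n \<in> PIdl (f [^] n) +> S n"
      using S fn by (auto simp: mem_principal_coset_iff intro!: bexI[of _ \<zero>])
    then have "S n \<in> PIdl (f [^] n) +> r" using fun_cong[OF r(2), of n] by simp
    then obtain x where x: "x \<in> carrier R" "S n = x \<otimes> f [^] n \<oplus> r"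
      by (auto simp: mem_principal_coset_iff)
    have "?u \<otimes> (x \<otimes> f [^] n \<oplus> r) = \<one> \<ominus> f [^] n \<otimes> t [^] n"
      using geom[of n] x(2) f t by (simp add: nat_pow_distrib)
    moreover have "?u \<otimes> r = ?u \<otimes> (x \<otimes> f [^] n \<oplus> r) \<ominus> ?u \<otimes> (x \<otimes> f [^] n)"
      using u(1) x(1) fn r(1) by algebra
    ultimately have "?u \<otimes> r = \<one> \<ominus> f [^] n \<otimes> t [^] n \<ominus> ?u \<otimes> (x \<otimes> f [^] n)"
      by simp
    also have "\<dots> = (\<ominus> (t [^] n) \<ominus> ?u \<otimes> x) \<otimes> f [^] n \<oplus> \<one>"
      using u(1) x(1) fn tn by algebra
    finally show "PIdl (f [^] n) +> (?u \<otimes> r) = PIdl (f [^] n) +> \<one>"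
      using u(1) x(1) fn tn by (intro principal_coset_cong) auto
  qed
  then have "?u \<otimes> r = \<one>"
    using bij u(1) r(1) unfolding bij_betw_def inj_on_def by blast
  then have "a \<otimes> (v \<otimes> r) = \<one>" using a v r(1) by (simp add: m_assoc)
  then show ?thesis using a v r(1) m_comm[of a "v \<otimes> r"] unfolding Units_def by auto
qed

section \<open>Generalized n-series modulo s(p)\<close>

locale n_series_cring = cring R for R (structure) +
  fixes s :: "nat \<Rightarrow> 'a"
  assumes series: "generalized_n_series R s"
begin

lemma s_closed [simp]: "s n \<in> carrier R"
  using series unfolding generalized_n_series_def by simp

lemma s_0 [simp]: "s 0 = \<zero>"
  using series unfolding generalized_n_series_def by simp

lemma s_cancel: "s n \<otimes> b = \<zero> \<Longrightarrow> n > 0 \<Longrightarrow> b \<in> carrier R \<Longrightarrow> b = \<zero>"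
  using series unfolding generalized_n_series_def non_zero_divisor_def by blast

lemma s_add:
  assumes "m > 0" "k > 0"
  obtains c where "c \<in> carrier R" "s (m + k) = s k \<oplus> s m \<otimes> c"
proof -
  have "s (m + k - k) divides (s (m + k) \<ominus> s k)"
    using series assms unfolding generalized_n_series_def by (meson less_add_same_cancel2)
  then obtain c where c: "c \<in> carrier R" "s (m + k) \<ominus> s k = s m \<otimes> c"
    unfolding factor_def by auto
  have "s (m + k) = s k \<oplus> (s (m + k) \<ominus> s k)" using s_closed[of k] s_closed[of "m+k"] by algebra
  with c show ?thesis using that by simp
qed

text \<open>
  Each step from \<open>j k\<close> to \<open>(j + 1) k\<close> changes the value by a multiple of \<open>s(k)\<close>, and the value at
  \<open>0\<close> is \<open>0\<close>. The defining divisibility only speaks of positive arguments, so the step from \<open>0\<close> is a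
  separate case.
\<close>

lemma s_divides_multiple:
  assumes "k > 0"
  shows "s k divides s (j * k)"
proof (induction j)
  case 0
  then show ?case by (auto simp: factor_def intro!: bexI[of _ \<zero>])
next
  case (Suc j)
  show ?case
  proof (cases "j = 0")
    case True
    then show ?thesis by (auto simp: factor_def intro!: bexI[of _ \<one>])
  next
    case False
    then obtain c where c: "c \<in> carrier R" "s (k + j * k) = s (j * k) \<oplus> s k \<otimes> c"
      using s_add[of k "j * k"] assms by auto
    obtain d where d: "d \<in> carrier R" "s (j * k) = s k \<otimes> d" using Suc by (auto simp: factor_def)
    have "s (Suc j * k) = s k \<otimes> (d \<oplus> c)" using c d by (simp add: r_distr)
    then show ?thesis using c d unfolding factor_def by auto
  qed
qed

text \<open>
  Modulo \<open>s(m)\<close> the values of \<open>s\<close> at positive arguments depend only on the argument modulo \<open>m\<close>; this is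
  the residue class of \<open>1\<close>.
\<close>

lemma s_Suc_multiple_cong:
  assumes "m > 0"
  shows "\<exists>c\<in>carrier R. s (Suc (m * j)) = s 1 \<oplus> s m \<otimes> c"
proof (induction j)
  case 0
  then show ?case by (auto intro!: bexI[of _ \<zero>])
next
  case (Suc j)
  then obtain d where d: "d \<in> carrier R" "s (Suc (m * j)) = s 1 \<oplus> s m \<otimes> d" by blast
  obtain c where c: "c \<in> carrier R" "s (m + Suc (m * j)) = s (Suc (m * j)) \<oplus> s m \<otimes> c"
    using s_add[of m "Suc (m * j)"] assms by auto
  have "s (Suc (m * Suc j)) = s 1 \<oplus> s m \<otimes> (d \<oplus> c)"
    using c d by (simp add: r_distr a_assoc)
  then show ?case using c d by blast
qed

text \<open>
  With \<open>k x = 1 + p y\<close> from Bezout, \<open>s(k)\<close> divides \<open>s(k x)\<close>, which is \<open>s(1)\<close> modulo \<open>s(p)\<close>. So \<open>s(k)\<close>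
  is invertible modulo \<open>s(p)\<close> as soon as \<open>s(1)\<close> is. Invertibility of \<open>a\<close> modulo \<open>c\<close> is expressed by an
  equation \<open>a v + c t = 1\<close>, which avoids computing in the quotient ring.
\<close>

lemma s_comaximal_of_coprime:
  assumes p: "Factorial_Ring.prime p" and k: "\<not> p dvd k"
    and vt: "v \<in> carrier R" "t \<in> carrier R" "s 1 \<otimes> v \<oplus> s p \<otimes> t = \<one>"
  shows "\<exists>v'\<in>carrier R. \<exists>t'\<in>carrier R. s k \<otimes> v' \<oplus> s p \<otimes> t' = \<one>"
proof -
  have pos: "p > 0" "k > 0" using p k by (auto simp: prime_gt_0_nat intro: gr0I)
  obtain x y where xy: "k * x = Suc (p * y)" using bezout_prime[OF p k] by blast
  obtain c where c: "c \<in> carrier R" "s (Suc (p * y)) = s 1 \<oplus> s p \<otimes> c"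
    using s_Suc_multiple_cong[OF pos(1)] by blast
  obtain d where d: "d \<in> carrier R" "s (x * k) = s k \<otimes> d"
    using s_divides_multiple[OF pos(2)] by (auto simp: factor_def)
  have e: "s k \<otimes> d = s 1 \<oplus> s p \<otimes> c" using c d xy by (simp add: mult.commute)
  have "s k \<otimes> (d \<otimes> v) \<oplus> s p \<otimes> (t \<ominus> c \<otimes> v) = (s k \<otimes> d) \<otimes> v \<oplus> s p \<otimes> (t \<ominus> c \<otimes> v)"
    using d vt by (simp add: m_assoc)
  also have "\<dots> = s 1 \<otimes> v \<oplus> s p \<otimes> t"
    unfolding e using c(1) vt(1,2) s_closed[of p] s_closed[of 1] by algebra
  finally show ?thesis using vt c d by (metis m_closed minus_closed)
qed

text \<open>
  Invertibility modulo \<open>s(p)\<close> lifts to \<open>R\<close> by completeness. Hence multiplication by \<open>s(k)\<close> is bijective,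
  which makes the part of \<open>\<eta>\<close> in weights prime to \<open>p\<close> acyclic.
\<close>

lemma s_Units_of_coprime:
  assumes p: "Factorial_Ring.prime p" and k: "\<not> p dvd k"
    and unit: "PIdl (s p) +> s 1 \<in> Units (R Quot (PIdl (s p)))"
    and complete: "adically_complete R (s p)"
  shows "s k \<in> Units R"
proof -
  obtain v t where "v \<in> carrier R" "t \<in> carrier R" "s 1 \<otimes> v \<oplus> s p \<otimes> t = \<one>"
    using unit_mod_principal_imp_comaximal[OF s_closed s_closed unit] by blast
  then obtain v' t' where "v' \<in> carrier R" "t' \<in> carrier R" "s k \<otimes> v' \<oplus> s p \<otimes> t' = \<one>"
    using s_comaximal_of_coprime[OF p k] by blast
  then show ?thesis
    by (intro adically_complete_comaximal_imp_Units[OF complete]) simp_all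
qed

end

section \<open>Cochain complexes and quasi-isomorphisms\<close>

lemma semilinear_mapD:
  assumes "semilinear_map R \<phi> M N h"
  shows "x \<in> carrier M \<Longrightarrow> h x \<in> carrier N"
    and "x \<in> carrier M \<Longrightarrow> y \<in> carrier M \<Longrightarrow> h (x \<oplus>\<^bsub>M\<^esub> y) = h x \<oplus>\<^bsub>N\<^esub> h y"
    and "r \<in> carrier R \<Longrightarrow> x \<in> carrier M \<Longrightarrow> h (r \<odot>\<^bsub>M\<^esub> x) = \<phi> r \<odot>\<^bsub>N\<^esub> h x"
  using assms unfolding semilinear_map_def by auto

lemma semilinear_map_hom:
  assumes "semilinear_map R \<phi> M N h" and "abelian_group M" and "abelian_group N"
  shows "abelian_group_hom M N h"
  by (intro abelian_group_homI assms(2,3) group_hom.intro group_hom_axioms.intro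
      abelian_group.a_group)
    (auto simp: hom_def semilinear_mapD[OF assms(1)])

lemma (in abelian_group_hom) hom_finsum:
  assumes "finite A" and "g \<in> A \<rightarrow> carrier G"
  shows "h (finsum G g A) = finsum H (\<lambda>a. h (g a)) A"
  using assms
proof (induction A rule: finite_induct)
  case (insert a A)
  then have "g \<in> A \<rightarrow> carrier G" "g a \<in> carrier G" by auto
  with insert show ?case by (simp add: G.finsum_insert H.finsum_insert Pi_def)
qed simp

lemma (in abelian_group_hom) image_add_subgroup: "additive_subgroup (h ` carrier G) H"
  by (intro additive_subgroupI group_hom.img_is_subgroup[OF a_group_hom, simplified])

locale complex_over =
  fixes R :: "('a, 'r) ring_scheme" (structure) and C :: "('a, 'b, 'm) cochain"
  assumes complex: "cochain_complex R C"
begin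

sublocale obj: module R "obj C i" for i
  using complex unfolding cochain_complex_def by blast

lemma diff_semilinear: "semilinear_map R (\<lambda>r. r) (obj C i) (obj C (Suc i)) (diff C i)"
  using complex unfolding cochain_complex_def by blast

sublocale diff: abelian_group_hom "obj C i" "obj C (Suc i)" "diff C i" for i
  by (rule semilinear_map_hom[OF diff_semilinear obj.abelian_group_axioms obj.abelian_group_axioms])

lemma diff_smult:
  "r \<in> carrier R \<Longrightarrow> x \<in> carrier (obj C i) \<Longrightarrow> diff C i (r \<odot>\<^bsub>obj C i\<^esub> x) = r \<odot>\<^bsub>obj C (Suc i)\<^esub> diff C i x"
  by (rule semilinear_mapD(3)[OF diff_semilinear])

lemma diff_diff: "x \<in> carrier (obj C i) \<Longrightarrow> diff C (Suc i) (diff C i x) = \<zero>\<^bsub>obj C (Suc (Suc i))\<^esub>"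
  using complex unfolding cochain_complex_def by blast

lemma cocycles_carrier: "z \<in> cocycles C i \<Longrightarrow> z \<in> carrier (obj C i)"
  unfolding cocycles_def by simp

lemma cocycles_add: "z \<in> cocycles C i \<Longrightarrow> w \<in> cocycles C i \<Longrightarrow> z \<oplus>\<^bsub>obj C i\<^esub> w \<in> cocycles C i"
  unfolding cocycles_def by simp

lemma coboundaries_subgroup: "abelian_subgroup (coboundaries C i) (obj C i)"
proof (cases i)
  case 0
  have "subgroup {\<zero>\<^bsub>obj C 0\<^esub>} (add_monoid (obj C 0))"
    using group.triv_subgroup[OF obj.a_group, of 0] by simp
  then show ?thesis
    using 0 by (auto intro!: abelian_subgroupI3 additive_subgroupI obj.abelian_group_axioms)
next
  case (Suc j)
  then show ?thesis
    by (auto intro!: abelian_subgroupI3 diff.image_add_subgroup obj.abelian_group_axioms)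
qed

lemma carrier_cohomology:
  "carrier (cohomology C i) = (\<lambda>z. coboundaries C i +>\<^bsub>obj C i\<^esub> z) ` cocycles C i"
  unfolding cohomology_def carrier_FactGroup a_r_coset_def r_coset_def by simp

lemma mult_cohomology:
  assumes "z \<in> cocycles C i" "w \<in> cocycles C i"
  shows "(coboundaries C i +>\<^bsub>obj C i\<^esub> z) \<otimes>\<^bsub>cohomology C i\<^esub> (coboundaries C i +>\<^bsub>obj C i\<^esub> w)
    = coboundaries C i +>\<^bsub>obj C i\<^esub> (z \<oplus>\<^bsub>obj C i\<^esub> w)"
proof -
  have "X \<otimes>\<^bsub>cohomology C i\<^esub> Y = X <+>\<^bsub>obj C i\<^esub> Y" for X Y
    unfolding cohomology_def by (simp add: set_add_def set_mult_def)
  then show ?thesis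
    using abelian_subgroup.a_rcos_sum[OF coboundaries_subgroup] assms cocycles_carrier by metis
qed

lemma coboundary_coset_eq_iff:
  assumes z: "z \<in> carrier (obj C i)" and w: "w \<in> carrier (obj C i)"
  shows "coboundaries C i +>\<^bsub>obj C i\<^esub> z = coboundaries C i +>\<^bsub>obj C i\<^esub> w
    \<longleftrightarrow> z \<ominus>\<^bsub>obj C i\<^esub> w \<in> coboundaries C i"
proof -
  interpret B: abelian_subgroup "coboundaries C i" "obj C i" by (rule coboundaries_subgroup)
  have "coboundaries C i +>\<^bsub>obj C i\<^esub> z = coboundaries C i +>\<^bsub>obj C i\<^esub> w
      \<longleftrightarrow> z \<in> coboundaries C i +>\<^bsub>obj C i\<^esub> w"
    using z w B.a_repr_independence' B.a_repr_independenceD B.a_rcos_self by metis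
  then show ?thesis using B.a_rcos_module[OF w z] by (simp add: a_minus_def)
qed

end

text \<open>
  A cochain map sends coboundaries to coboundaries, so all members of the union that defines
  \<^const>\<open>cohomology_map\<close> coincide.
\<close>

lemma cohomology_map_coset:
  assumes f: "cochain_map R C D f" and z: "z \<in> carrier (obj C i)"
  shows "cohomology_map D f i (coboundaries C i +>\<^bsub>obj C i\<^esub> z) = coboundaries D i +>\<^bsub>obj D i\<^esub> f i z"
proof -
  interpret C: complex_over R C
    using f unfolding semilinear_cochain_map_def by unfold_locales blast
  interpret D: complex_over R D
    using f unfolding semilinear_cochain_map_def by unfold_locales blast
  have f_lin: "\<And>j. semilinear_map R (\<lambda>r. r) (obj C j) (obj D j) (f j)"
    and f_diff: "\<And>j x. x \<in> carrier (obj C j) \<Longrightarrow> f (Suc j) (diff C j x) = diff D j (f j x)"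
    using f unfolding semilinear_cochain_map_def by blast+
  interpret f: abelian_group_hom "obj C j" "obj D j" "f j" for j
    by (rule semilinear_map_hom[OF f_lin C.obj.abelian_group_axioms D.obj.abelian_group_axioms])
  interpret BC: abelian_subgroup "coboundaries C i" "obj C i" by (rule C.coboundaries_subgroup)
  interpret BD: abelian_subgroup "coboundaries D i" "obj D i" by (rule D.coboundaries_subgroup)
  have fB: "f i b \<in> coboundaries D i" if "b \<in> coboundaries C i" for b
    using that by (cases i) (auto simp: f_diff)
  have const: "coboundaries D i +>\<^bsub>obj D i\<^esub> f i (b \<oplus>\<^bsub>obj C i\<^esub> z) = coboundaries D i +>\<^bsub>obj D i\<^esub> f i z"
    if "b \<in> coboundaries C i" for b
  proof (intro BD.a_repr_independence'[symmetric])
    show "f i (b \<oplus>\<^bsub>obj C i\<^esub> z) \<in> coboundaries D i +>\<^bsub>obj D i\<^esub> f i z"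
      using fB[OF that] that z by (auto simp: a_r_coset_def')
  qed (use z in simp)
  have "\<zero>\<^bsub>obj C i\<^esub> \<in> coboundaries C i" by simp
  then have "coboundaries C i \<noteq> {}" by blast
  then show ?thesis
    unfolding cohomology_map_def a_r_coset_def'[of "obj C i"] by (simp add: const)
qed

text \<open>
  The hypotheses say that \<open>f\<close> is injective and that its cokernel is acyclic, without mentioning the
  quotient complex: a class of the cokernel is a cocycle exactly if \<open>diff D i z\<close> lies in the image of
  \<open>f\<close>. The long exact cohomology sequence would give the conclusion; the proof is the diagram chase in
  the two places where that sequence is needed.
\<close>

lemma quasi_isomorphismI:
  assumes f: "cochain_map R C D f"
    and inj: "\<And>i x. x \<in> carrier (obj C i) \<Longrightarrow> f i x = \<zero>\<^bsub>obj D i\<^esub> \<Longrightarrow> x = \<zero>\<^bsub>obj C i\<^esub>"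
    and acyclic: "\<And>i z. z \<in> carrier (obj D i) \<Longrightarrow> diff D i z \<in> f (Suc i) ` carrier (obj C (Suc i)) \<Longrightarrow>
      \<exists>c\<in>carrier (obj C i). \<exists>b\<in>coboundaries D i. z = f i c \<oplus>\<^bsub>obj D i\<^esub> b"
  shows "quasi_isomorphism R C D f"
proof -
  interpret C: complex_over R C
    using f unfolding semilinear_cochain_map_def by unfold_locales blast
  interpret D: complex_over R D
    using f unfolding semilinear_cochain_map_def by unfold_locales blast
  have f_lin: "\<And>j. semilinear_map R (\<lambda>r. r) (obj C j) (obj D j) (f j)"
    and f_diff: "\<And>j x. x \<in> carrier (obj C j) \<Longrightarrow> f (Suc j) (diff C j x) = diff D j (f j x)"
    using f unfolding semilinear_cochain_map_def by blast+
  interpret f: abelian_group_hom "obj C j" "obj D j" "f j" for j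
    by (rule semilinear_map_hom[OF f_lin C.obj.abelian_group_axioms D.obj.abelian_group_axioms])
  have f_inj: "x = y"
    if "x \<in> carrier (obj C j)" "y \<in> carrier (obj C j)" "f j x = f j y" for j x y
  proof -
    have "f j (x \<ominus>\<^bsub>obj C j\<^esub> y) = \<zero>\<^bsub>obj D j\<^esub>"
      using that by (simp add: a_minus_def D.obj.r_neg)
    then have "x \<ominus>\<^bsub>obj C j\<^esub> y = \<zero>\<^bsub>obj C j\<^esub>" using inj that by simp
    then show ?thesis
      using C.obj.minus_equality[of j x "\<ominus>\<^bsub>obj C j\<^esub> y"] that by (simp add: a_minus_def)
  qed
  have f_Z: "f i z \<in> cocycles D i" if "z \<in> cocycles C i" for i z
    using that f_diff[of z i] unfolding cocycles_def by simp
  \<comment> \<open>If \<open>f c = d z\<close>, write \<open>z = f e + b\<close>; then \<open>f c = f (d e)\<close>. This yields injectivity on cohomology.\<close>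
  have reflect: "c \<in> coboundaries C i" if c: "c \<in> carrier (obj C i)" "f i c \<in> coboundaries D i" for i c
  proof (cases i)
    case 0
    then show ?thesis using c inj by simp
  next
    case (Suc j)
    then obtain z where z: "z \<in> carrier (obj D j)" "f (Suc j) c = diff D j z" using c by auto
    obtain e b where e: "e \<in> carrier (obj C j)" "b \<in> coboundaries D j" "z = f j e \<oplus>\<^bsub>obj D j\<^esub> b"
      using acyclic[OF z(1)] z c Suc by (metis imageI)
    have b: "b \<in> carrier (obj D j)" "diff D j b = \<zero>\<^bsub>obj D (Suc j)\<^esub>"
      using e(2) by (cases j; auto simp: D.diff_diff)+
    have "f (Suc j) c = f (Suc j) (diff C j e)"
      using z(2) e b by (simp add: f_diff)
    then have "c = diff C j e" using f_inj c(1) Suc e(1) by simp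
    then show ?thesis using Suc e(1) by simp
  qed
  have iso: "cohomology_map D f i \<in> iso (cohomology C i) (cohomology D i)" for i
  proof -
    let ?B = "\<lambda>z. coboundaries C i +>\<^bsub>obj C i\<^esub> z" and ?B' = "\<lambda>z. coboundaries D i +>\<^bsub>obj D i\<^esub> z"
    have map: "cohomology_map D f i (?B z) = ?B' (f i z)" if "z \<in> cocycles C i" for z
      by (rule cohomology_map_coset[OF f C.cocycles_carrier[OF that]])
    have "cohomology_map D f i \<in> hom (cohomology C i) (cohomology D i)"
    proof (rule homI)
      show "cohomology_map D f i X \<in> carrier (cohomology D i)" if "X \<in> carrier (cohomology C i)" for X
        using that by (auto simp: C.carrier_cohomology D.carrier_cohomology map f_Z)
      show "cohomology_map D f i (X \<otimes>\<^bsub>cohomology C i\<^esub> Y) =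
          cohomology_map D f i X \<otimes>\<^bsub>cohomology D i\<^esub> cohomology_map D f i Y"
        if "X \<in> carrier (cohomology C i)" "Y \<in> carrier (cohomology C i)" for X Y
        using that by (auto simp: C.carrier_cohomology map f_Z C.mult_cohomology D.mult_cohomology
            C.cocycles_add C.cocycles_carrier)
    qed
    moreover have "inj_on (cohomology_map D f i) (carrier (cohomology C i))"
    proof (rule inj_onI)
      fix X Y assume "X \<in> carrier (cohomology C i)" "Y \<in> carrier (cohomology C i)"
        and eq: "cohomology_map D f i X = cohomology_map D f i Y"
      then obtain z w where zw: "z \<in> cocycles C i" "X = ?B z" "w \<in> cocycles C i" "Y = ?B w"
        by (auto simp: C.carrier_cohomology)
      then have c: "z \<in> carrier (obj C i)" "w \<in> carrier (obj C i)" by (auto dest: C.cocycles_carrier)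
      have "?B' (f i z) = ?B' (f i w)" using eq zw by (simp add: map)
      then have "f i z \<ominus>\<^bsub>obj D i\<^esub> f i w \<in> coboundaries D i"
        using c by (simp add: D.coboundary_coset_eq_iff)
      then have "z \<ominus>\<^bsub>obj C i\<^esub> w \<in> coboundaries C i"
        using c by (intro reflect) (simp_all add: a_minus_def)
      then show "X = Y" using c zw by (simp add: C.coboundary_coset_eq_iff)
    qed
    \<comment> \<open>A cocycle \<open>z\<close> of \<open>D\<close> has \<open>d z = f 0\<close>, so it is cohomologous to some \<open>f c\<close>, and \<open>c\<close> is a cocycle.\<close>
    moreover have "carrier (cohomology D i) \<subseteq> cohomology_map D f i ` carrier (cohomology C i)"
    proof
      fix Y assume "Y \<in> carrier (cohomology D i)"
      then obtain z where z: "z \<in> cocycles D i" "Y = ?B' z" by (auto simp: D.carrier_cohomology)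
      have "f (Suc i) \<zero>\<^bsub>obj C (Suc i)\<^esub> = \<zero>\<^bsub>obj D (Suc i)\<^esub>" by simp
      then have "diff D i z \<in> f (Suc i) ` carrier (obj C (Suc i))"
        using z(1) unfolding cocycles_def by (metis (mono_tags, lifting) C.obj.zero_closed imageI mem_Collect_eq)
      then obtain c b where cb: "c \<in> carrier (obj C i)" "b \<in> coboundaries D i" "z = f i c \<oplus>\<^bsub>obj D i\<^esub> b"
        using acyclic z(1) D.cocycles_carrier by meson
      have b: "b \<in> carrier (obj D i)" "diff D i b = \<zero>\<^bsub>obj D (Suc i)\<^esub>"
        using cb(2) by (cases i; auto simp: D.diff_diff)+
      have "diff D i (f i c) = \<zero>\<^bsub>obj D (Suc i)\<^esub>"
        using z(1) cb(1,3) b unfolding cocycles_def by simp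
      then have "f (Suc i) (diff C i c) = \<zero>\<^bsub>obj D (Suc i)\<^esub>" using cb(1) by (simp add: f_diff)
      then have c: "c \<in> cocycles C i" using inj cb(1) unfolding cocycles_def by simp
      have "z \<ominus>\<^bsub>obj D i\<^esub> f i c = b"
        using cb b by (simp add: a_minus_def D.obj.a_ac D.obj.r_neg2 D.obj.r_neg1 D.obj.r_neg)
      then have "Y = ?B' (f i c)"
        using z cb b by (simp add: D.coboundary_coset_eq_iff)
      then show "Y \<in> cohomology_map D f i ` carrier (cohomology C i)"
        using c map by (auto simp: C.carrier_cohomology)
    qed
    ultimately show ?thesis
      unfolding iso_def bij_betw_def hom_def by auto
  qed
  then show ?thesis using f unfolding quasi_isomorphism_def by blast
qed

section \<open>The subcomplex of divisible elements\<close>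

lemma diff_eta [simp]: "diff (eta R f C) = diff C"
  by (simp add: eta_def)

lemma carrier_obj_eta:
  "z \<in> carrier (obj (eta R f C) i) \<longleftrightarrow>
    (\<exists>y\<in>carrier (obj C i). z = (f [^]\<^bsub>R\<^esub> i) \<odot>\<^bsub>obj C i\<^esub> y) \<and>
    (\<exists>y\<in>carrier (obj C (Suc i)). diff C i z = (f [^]\<^bsub>R\<^esub> Suc i) \<odot>\<^bsub>obj C (Suc i)\<^esub> y)"
  by (simp add: eta_def)

lemma obj_eta: "obj (eta R f C) i = obj C i\<lparr>carrier := carrier (obj (eta R f C) i)\<rparr>"
  by (simp add: eta_def)

lemma obj_eta_ops [simp]:
  "ring.add (obj (eta R f C) i) = ring.add (obj C i)" "ring.zero (obj (eta R f C) i) = ring.zero (obj C i)"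
  "smult (obj (eta R f C) i) = smult (obj C i)"
  by (simp_all add: eta_def)

context complex_over
begin

lemma carrier_eta_subset:
  "f \<in> carrier R \<Longrightarrow> z \<in> carrier (obj (eta R f C) i) \<Longrightarrow> z \<in> carrier (obj C i)"
  by (auto simp: carrier_obj_eta)

lemma eta_submodule:
  assumes f: "f \<in> carrier R"
  shows "submodule (carrier (obj (eta R f C) i)) R (obj C i)"
proof (rule obj.submoduleI)
  have fi: "f [^] n \<in> carrier R" for n :: nat using f by simp
  have mult: "r \<odot>\<^bsub>obj C j\<^esub> ((f [^] n) \<odot>\<^bsub>obj C j\<^esub> y) = (f [^] n) \<odot>\<^bsub>obj C j\<^esub> (r \<odot>\<^bsub>obj C j\<^esub> y)"
    if "r \<in> carrier R" "y \<in> carrier (obj C j)" for r y j and n :: nat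
    using that fi by (simp add: obj.smult_assoc1[symmetric] obj.m_comm)
  note nat_pow_Suc [simp del]
  show "carrier (obj (eta R f C) i) \<subseteq> carrier (obj C i)"
    using carrier_eta_subset f by blast
  show "\<zero>\<^bsub>obj C i\<^esub> \<in> carrier (obj (eta R f C) i)"
    unfolding carrier_obj_eta
    using fi by (metis diff.hom_zero obj.smult_r_null obj.zero_closed)
  show smul: "a \<odot>\<^bsub>obj C i\<^esub> x \<in> carrier (obj (eta R f C) i)"
    if "a \<in> carrier R" "x \<in> carrier (obj (eta R f C) i)" for a x
    using that(2) carrier_eta_subset[OF f that(2)] that(1) unfolding carrier_obj_eta
    by (metis diff_smult mult obj.smult_closed)
  show "x \<oplus>\<^bsub>obj C i\<^esub> y \<in> carrier (obj (eta R f C) i)"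
    if "x \<in> carrier (obj (eta R f C) i)" "y \<in> carrier (obj (eta R f C) i)" for x y
    using that carrier_eta_subset[OF f that(1)] carrier_eta_subset[OF f that(2)] fi
    unfolding carrier_obj_eta
    by (metis diff.hom_add obj.a_closed obj.smult_r_distr)
  show "\<ominus>\<^bsub>obj C i\<^esub> x \<in> carrier (obj (eta R f C) i)"
    if "x \<in> carrier (obj (eta R f C) i)" for x
  proof -
    have "\<ominus>\<^bsub>obj C i\<^esub> x = (\<ominus> \<one>) \<odot>\<^bsub>obj C i\<^esub> x"
      using carrier_eta_subset[OF f that] by (simp add: obj.smult_l_minus)
    then show ?thesis using smul[of "\<ominus> \<one>" x] that by simp
  qed
qed

lemma eta_complex:
  assumes f: "f \<in> carrier R"
  shows "cochain_complex R (eta R f C)"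
  unfolding cochain_complex_def
proof (intro conjI allI ballI)
  fix i
  have "module R (obj C i\<lparr>carrier := carrier (obj (eta R f C) i)\<rparr>)"
    by (rule submodule.submodule_is_module[OF eta_submodule[OF f] obj.module_axioms])
  then show "module R (obj (eta R f C) i)" by (simp only: obj_eta[symmetric])
  have "diff C i z \<in> carrier (obj (eta R f C) (Suc i))" if "z \<in> carrier (obj (eta R f C) i)" for z
  proof -
    have "diff C (Suc i) (diff C i z) = (f [^] Suc (Suc i)) \<odot>\<^bsub>obj C (Suc (Suc i))\<^esub> \<zero>\<^bsub>obj C (Suc (Suc i))\<^esub>"
      using carrier_eta_subset[OF f that] f diff_diff by (simp del: nat_pow_Suc)
    then show ?thesis using that unfolding carrier_obj_eta by blast
  qed
  then show "semilinear_map R (\<lambda>r. r) (obj (eta R f C) i) (obj (eta R f C) (Suc i)) (diff (eta R f C) i)"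
    unfolding semilinear_map_def using carrier_eta_subset[OF f] by (auto simp: diff_smult)
  show "diff (eta R f C) (Suc i) (diff (eta R f C) i x) = \<zero>\<^bsub>obj (eta R f C) (Suc (Suc i))\<^esub>"
    if "x \<in> carrier (obj (eta R f C) i)" for x
    using carrier_eta_subset[OF f that] by (simp add: diff_diff)
qed

end

text \<open>
  Divisibility of the values of \<open>h\<close> in every degree is enough: the condition on \<open>d (h x)\<close> is the
  divisibility of \<open>h (d x)\<close> one degree higher.
\<close>

lemma semilinear_cochain_map_into_eta:
  assumes h: "semilinear_cochain_map R S \<phi> C D h" and f: "f \<in> carrier S"
    and div: "\<And>i x. x \<in> carrier (obj C i) \<Longrightarrow> \<exists>y\<in>carrier (obj D i). h i x = (f [^]\<^bsub>S\<^esub> i) \<odot>\<^bsub>obj D i\<^esub> y"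
  shows "semilinear_cochain_map R S \<phi> C (eta S f D) h"
proof -
  interpret C: complex_over R C
    using h unfolding semilinear_cochain_map_def by unfold_locales blast
  interpret D: complex_over S D
    using h unfolding semilinear_cochain_map_def by unfold_locales blast
  have h_lin: "\<And>i. semilinear_map R \<phi> (obj C i) (obj D i) (h i)"
    and h_diff: "\<And>i x. x \<in> carrier (obj C i) \<Longrightarrow> h (Suc i) (diff C i x) = diff D i (h i x)"
    using h unfolding semilinear_cochain_map_def by blast+
  have "h i x \<in> carrier (obj (eta S f D) i)" if "x \<in> carrier (obj C i)" for i x
    unfolding carrier_obj_eta using div[OF that] div[of "diff C i x" "Suc i"] h_diff[OF that] that
    by auto
  then have "semilinear_map R \<phi> (obj C i) (obj (eta S f D) i) (h i)" for i
    using h_lin[of i] unfolding semilinear_map_def by auto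
  then show ?thesis
    using h D.eta_complex[OF f] unfolding semilinear_cochain_map_def by simp
qed

section \<open>Extension of scalars\<close>

text \<open>
  Extension of scalars along \<open>\<phi>\<close>. The aim is to replace computations with classes of formal sums by
  the rules for pure tensors, induction over sums of pure tensors, and the universal property.
\<close>

locale scalar_extension = R: cring R + S: cring S + M: module R M
  for R :: "('a, 'r) ring_scheme" and S :: "('c, 's) ring_scheme" and M :: "('a, 'b, 'm) module_scheme" +
  fixes \<phi> :: "'a \<Rightarrow> 'c"
  assumes \<phi>: "\<phi> \<in> ring_hom R S"
begin

abbreviation "F \<equiv> free_Abelian_group (carrier S \<times> carrier M)"
abbreviation "N \<equiv> tensor_null R S \<phi> M"
abbreviation "T \<equiv> base_change_module R S \<phi> M"
abbreviation "cls \<equiv> tensor_class R S \<phi> M"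
abbreviation "pure \<equiv> pure_tensor R S \<phi> M"

lemma phi_closed [simp]: "r \<in> carrier R \<Longrightarrow> \<phi> r \<in> carrier S"
  using \<phi> by (rule ring_hom_closed)

lemma relators_subset: "tensor_relators R S \<phi> M \<subseteq> carrier F"
  unfolding tensor_relators_def
  by (auto dest!: subsetD[OF keys_diff] simp: keys_frag_of)

lemma null_normal: "N \<lhd> F"
proof -
  interpret F: comm_group F by (rule abelian_free_Abelian_group)
  show ?thesis
    unfolding tensor_null_def
    by (intro iffD2[OF F.normal_iff_subgroup] F.generate_is_subgroup relators_subset)
qed

lemma null_subgroup: "subgroup N F"
  by (rule normal_imp_subgroup[OF null_normal])

lemma tensor_additive_structure:
  "carrier T = carrier (F Mod N)" "ring.add T = monoid.mult (F Mod N)" "ring.zero T = one (F Mod N)"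
  by (simp_all add: base_change_module_def Let_def)

lemma tensor_abelian_group: "abelian_group T"
proof -
  interpret Q: comm_group "F Mod N"
    by (rule comm_group.abelian_FactGroup[OF abelian_free_Abelian_group null_subgroup])
  show ?thesis
    by (rule abelian_groupI, unfold tensor_additive_structure)
      (rule Q.m_closed Q.one_closed Q.m_assoc Q.m_comm Q.l_one Q.l_inv_ex; assumption)+
qed

sublocale T: abelian_group T
  by (rule tensor_abelian_group)

lemma carrier_tensor: "carrier T = cls ` {u. Poly_Mapping.keys u \<subseteq> carrier S \<times> carrier M}"
  by (auto simp: base_change_module_def Let_def carrier_FactGroup tensor_class_def)

lemma class_closed [simp]:
  "Poly_Mapping.keys u \<subseteq> carrier S \<times> carrier M \<Longrightarrow> cls u \<in> carrier T"
  by (simp add: carrier_tensor)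

lemma add_class:
  assumes "Poly_Mapping.keys u \<subseteq> carrier S \<times> carrier M" "Poly_Mapping.keys v \<subseteq> carrier S \<times> carrier M"
  shows "cls u \<oplus>\<^bsub>T\<^esub> cls v = cls (u + v)"
  using normal.rcos_sum[OF null_normal, of u v] assms
  by (simp add: base_change_module_def Let_def tensor_class_def)

lemma null_add: "u \<in> N \<Longrightarrow> v \<in> N \<Longrightarrow> u + v \<in> N"
  using subgroup.m_closed[OF null_subgroup] by simp

lemma null_keys: "u \<in> N \<Longrightarrow> Poly_Mapping.keys u \<subseteq> carrier S \<times> carrier M"
  using subgroup.mem_carrier[OF null_subgroup] by simp

lemma null_uminus: "u \<in> N \<Longrightarrow> - u \<in> N"
  using subgroup.m_inv_closed[OF null_subgroup, of u] null_keys[of u] by simp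

lemma class_cong:
  assumes u: "Poly_Mapping.keys u \<subseteq> carrier S \<times> carrier M"
    and v: "Poly_Mapping.keys v \<subseteq> carrier S \<times> carrier M" and uv: "u - v \<in> N"
  shows "cls u = cls v"
proof -
  have "u \<in> N #>\<^bsub>F\<^esub> v"
    unfolding r_coset_def using uv by (auto intro!: bexI[of _ "u - v"])
  then show ?thesis
    unfolding tensor_class_def
    using group.repr_independence[OF group_free_Abelian_group _ _ null_subgroup] v by simp
qed

lemma pure_closed [simp]: "a \<in> carrier S \<Longrightarrow> m \<in> carrier M \<Longrightarrow> pure a m \<in> carrier T"
  by (simp add: pure_tensor_def keys_frag_of)

lemma relator_in_null: "u \<in> tensor_relators R S \<phi> M \<Longrightarrow> u \<in> N"
  unfolding tensor_null_def by (rule generate.incl)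

lemma pure_add_left:
  assumes "a \<in> carrier S" "b \<in> carrier S" "m \<in> carrier M"
  shows "pure (a \<oplus>\<^bsub>S\<^esub> b) m = pure a m \<oplus>\<^bsub>T\<^esub> pure b m"
proof -
  have "frag_of (a \<oplus>\<^bsub>S\<^esub> b, m) - frag_of (a, m) - frag_of (b, m) \<in> N"
    by (rule relator_in_null) (use assms in \<open>unfold tensor_relators_def, blast\<close>)
  then have "cls (frag_of (a \<oplus>\<^bsub>S\<^esub> b, m)) = cls (frag_of (a, m) + frag_of (b, m))"
    using assms by (intro class_cong) (auto simp: keys_frag_of diff_diff_eq dest!: subsetD[OF keys_add])
  then show ?thesis using assms by (simp add: pure_tensor_def add_class keys_frag_of)
qed

lemma pure_add_right:
  assumes "a \<in> carrier S" "m \<in> carrier M" "n \<in> carrier M"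
  shows "pure a (m \<oplus>\<^bsub>M\<^esub> n) = pure a m \<oplus>\<^bsub>T\<^esub> pure a n"
proof -
  have "frag_of (a, m \<oplus>\<^bsub>M\<^esub> n) - frag_of (a, m) - frag_of (a, n) \<in> N"
    by (rule relator_in_null) (use assms in \<open>unfold tensor_relators_def, blast\<close>)
  then have "cls (frag_of (a, m \<oplus>\<^bsub>M\<^esub> n)) = cls (frag_of (a, m) + frag_of (a, n))"
    using assms by (intro class_cong) (auto simp: keys_frag_of diff_diff_eq dest!: subsetD[OF keys_add])
  then show ?thesis using assms by (simp add: pure_tensor_def add_class keys_frag_of)
qed

lemma pure_smult:
  assumes "a \<in> carrier S" "r \<in> carrier R" "m \<in> carrier M"
  shows "pure a (r \<odot>\<^bsub>M\<^esub> m) = pure (a \<otimes>\<^bsub>S\<^esub> \<phi> r) m"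
proof -
  have "frag_of (a \<otimes>\<^bsub>S\<^esub> \<phi> r, m) - frag_of (a, r \<odot>\<^bsub>M\<^esub> m) \<in> N"
    by (rule relator_in_null) (use assms in \<open>unfold tensor_relators_def, blast\<close>)
  then show ?thesis
    using assms unfolding pure_tensor_def by (intro class_cong[symmetric]) (auto simp: keys_frag_of)
qed

lemma pure_zero_left: "m \<in> carrier M \<Longrightarrow> pure \<zero>\<^bsub>S\<^esub> m = \<zero>\<^bsub>T\<^esub>"
  using pure_add_left[of "\<zero>\<^bsub>S\<^esub>" "\<zero>\<^bsub>S\<^esub>" m] T.add.r_cancel_one'[of "pure \<zero>\<^bsub>S\<^esub> m" "pure \<zero>\<^bsub>S\<^esub> m"]
  by simp

lemma pure_zero_right: "a \<in> carrier S \<Longrightarrow> pure a \<zero>\<^bsub>M\<^esub> = \<zero>\<^bsub>T\<^esub>"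
  using pure_add_right[of a "\<zero>\<^bsub>M\<^esub>" "\<zero>\<^bsub>M\<^esub>"]
    T.add.r_cancel_one'[of "pure a \<zero>\<^bsub>M\<^esub>" "pure a \<zero>\<^bsub>M\<^esub>"]
  by simp

lemma pure_minus_left:
  assumes "a \<in> carrier S" "m \<in> carrier M"
  shows "pure (\<ominus>\<^bsub>S\<^esub> a) m = \<ominus>\<^bsub>T\<^esub> pure a m"
  using pure_add_left[of "\<ominus>\<^bsub>S\<^esub> a" a m] assms
  by (intro T.minus_equality[symmetric]) (simp_all add: S.l_neg pure_zero_left)

text \<open>
  The negative of a pure tensor \<open>a \<otimes> m\<close> is the pure tensor \<open>(- a) \<otimes> m\<close>, and zero is pure, so sums of
  pure tensors exhaust the tensor product.
\<close>

lemma tensor_induct [consumes 1, case_names pure add]: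
  assumes X: "X \<in> carrier T"
    and pure: "\<And>a m. a \<in> carrier S \<Longrightarrow> m \<in> carrier M \<Longrightarrow> P (pure a m)"
    and add: "\<And>X Y. X \<in> carrier T \<Longrightarrow> Y \<in> carrier T \<Longrightarrow> P X \<Longrightarrow> P Y \<Longrightarrow> P (X \<oplus>\<^bsub>T\<^esub> Y)"
  shows "P X"
proof -
  obtain u where u: "Poly_Mapping.keys u \<subseteq> carrier S \<times> carrier M" "X = cls u"
    using X by (auto simp: carrier_tensor)
  \<comment> \<open>Carrying the statement for \<open>- u\<close> along reduces differences to sums.\<close>
  have "P (cls u) \<and> P (cls (- u))"
    using u(1)
  proof (induction u rule: free_Abelian_group_induct [consumes 1, case_names zero diff generator])
    case zero
    have "cls 0 = \<zero>\<^bsub>T\<^esub>"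
      using add_class[of 0 0] T.add.r_cancel_one'[of "cls 0" "cls 0"] by simp
    then show ?case using pure[of "\<zero>\<^bsub>S\<^esub>" "\<zero>\<^bsub>M\<^esub>"] by (simp add: pure_zero_left)
  next
    case (diff x y)
    have "P (cls (x + - y))" "P (cls (y + - x))"
      using diff add[of "cls x" "cls (- y)"] add[of "cls y" "cls (- x)"]
      by (simp_all add: add_class)
    then show ?case by simp
  next
    case (generator z)
    then obtain a m where z: "z = (a, m)" "a \<in> carrier S" "m \<in> carrier M" by auto
    have k: "Poly_Mapping.keys (frag_of z) \<subseteq> carrier S \<times> carrier M" using generator by (simp add: keys_frag_of)
    have "cls (- frag_of z) \<oplus>\<^bsub>T\<^esub> cls (frag_of z) = \<zero>\<^bsub>T\<^esub>"
      using k add_class[of "- frag_of z" "frag_of z"] add_class[of 0 0] T.add.r_cancel_one'[of "cls 0" "cls 0"]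
      by simp
    then have "\<ominus>\<^bsub>T\<^esub> cls (frag_of z) = cls (- frag_of z)"
      using k by (intro T.minus_equality) simp_all
    then have "cls (- frag_of z) = pure (\<ominus>\<^bsub>S\<^esub> a) m"
      using pure_minus_left[OF z(2,3)] by (simp add: z(1) pure_tensor_def)
    moreover have "cls (frag_of z) = pure a m" by (simp add: z(1) pure_tensor_def)
    ultimately show ?case using pure z(2,3) by simp
  qed
  then show ?thesis using u(2) by simp
qed

end

text \<open>
  A map of generators that respects the relations descends to the tensor products. This evaluates the
  unions in the definitions of \<^const>\<open>base_change_module\<close> and \<^const>\<open>base_change_map\<close> on any
  representative.
\<close>

lemma class_frag_extend:
  assumes "scalar_extension R S M \<phi>" and "scalar_extension R' S' M' \<phi>'"
    and k: "\<And>a m. a \<in> carrier S \<Longrightarrow> m \<in> carrier M \<Longrightarrow> Poly_Mapping.keys (k (a, m)) \<subseteq> carrier S' \<times> carrier M'"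
    and rel: "\<And>u. u \<in> tensor_relators R S \<phi> M \<Longrightarrow> frag_extend k u \<in> tensor_null R' S' \<phi>' M'"
    and u: "Poly_Mapping.keys u \<subseteq> carrier S \<times> carrier M"
  shows "(\<Union>v\<in>tensor_class R S \<phi> M u. tensor_class R' S' \<phi>' M' (frag_extend k v)) =
    tensor_class R' S' \<phi>' M' (frag_extend k u)"
    and "Poly_Mapping.keys (frag_extend k u) \<subseteq> carrier S' \<times> carrier M'"
proof -
  interpret A: scalar_extension R S M \<phi> by fact
  interpret B: scalar_extension R' S' M' \<phi>' by fact
  have keys: "Poly_Mapping.keys (frag_extend k v) \<subseteq> carrier S' \<times> carrier M'"
    if v: "Poly_Mapping.keys v \<subseteq> carrier S \<times> carrier M" for v
  proof (rule subset_trans[OF keys_frag_extend])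
    show "(\<Union>z\<in>Poly_Mapping.keys v. Poly_Mapping.keys (k z)) \<subseteq> carrier S' \<times> carrier M'"
    proof (rule UN_least)
      fix z assume "z \<in> Poly_Mapping.keys v"
      then obtain a m where "z = (a, m)" "a \<in> carrier S" "m \<in> carrier M" using v by blast
      then show "Poly_Mapping.keys (k z) \<subseteq> carrier S' \<times> carrier M'" using k by simp
    qed
  qed
  then show "Poly_Mapping.keys (frag_extend k u) \<subseteq> carrier S' \<times> carrier M'" using u by blast
  have null: "frag_extend k v \<in> B.N" if "v \<in> A.N" for v
    using that unfolding tensor_null_def[of R S]
  proof (induction v rule: generate.induct)
    case one
    then show ?case using subgroup.one_closed[OF B.null_subgroup] by simp
  next
    case (incl h)
    then show ?case by (rule rel)
  next
    case (inv h)
    then have "Poly_Mapping.keys h \<subseteq> carrier S \<times> carrier M" using subsetD[OF A.relators_subset inv] by simp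
    then show ?case using rel[OF inv] by (simp add: frag_extend_minus B.null_uminus)
  next
    case (eng h1 h2)
    then show ?case by (simp add: frag_extend_add B.null_add)
  qed
  have "tensor_class R' S' \<phi>' M' (frag_extend k v) = tensor_class R' S' \<phi>' M' (frag_extend k u)"
    if "v \<in> A.cls u" for v
  proof -
    obtain n where n: "n \<in> A.N" "v = n + u"
      using \<open>v \<in> A.cls u\<close> unfolding tensor_class_def r_coset_def by auto
    have v: "Poly_Mapping.keys v \<subseteq> carrier S \<times> carrier M"
      using n u A.null_keys[OF n(1)] keys_add[of n u] by blast
    have "frag_extend k v - frag_extend k u \<in> B.N"
      using null[OF n(1)] by (simp add: n(2) frag_extend_add)
    then show ?thesis
      by (intro B.class_cong keys u v)
  qed
  moreover have "u \<in> A.cls u"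
    unfolding tensor_class_def r_coset_def
    using subgroup.one_closed[OF A.null_subgroup] by (auto intro!: bexI[of _ 0])
  ultimately show "(\<Union>v\<in>A.cls u. tensor_class R' S' \<phi>' M' (frag_extend k v)) =
      tensor_class R' S' \<phi>' M' (frag_extend k u)"
    by blast
qed

context scalar_extension
begin

lemma scalar_extension: "scalar_extension R S M \<phi>" ..

lemma smult_class:
  assumes c: "c \<in> carrier S" and u: "Poly_Mapping.keys u \<subseteq> carrier S \<times> carrier M"
  defines "k \<equiv> \<lambda>(a, m). frag_of (c \<otimes>\<^bsub>S\<^esub> a, m)"
  shows "c \<odot>\<^bsub>T\<^esub> cls u = cls (frag_extend k u)"
    and "Poly_Mapping.keys (frag_extend k u) \<subseteq> carrier S \<times> carrier M"
proof -
  have rel: "frag_extend k v \<in> N" if "v \<in> tensor_relators R S \<phi> M" for v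
  proof (rule relator_in_null)
    have c': "c \<otimes>\<^bsub>S\<^esub> a \<in> carrier S" if "a \<in> carrier S" for a using c that by simp
    show "frag_extend k v \<in> tensor_relators R S \<phi> M"
      using \<open>v \<in> tensor_relators R S \<phi> M\<close>
      unfolding tensor_relators_def
      by (elim UnE CollectE exE conjE; simp add: k_def frag_extend_diff S.r_distr c S.m_assoc[symmetric])
        (use c' in blast)+
  qed
  have keys: "Poly_Mapping.keys (k (a, m)) \<subseteq> carrier S \<times> carrier M"
    if "a \<in> carrier S" "m \<in> carrier M" for a m
    using c that by (simp add: k_def keys_frag_of)
  show "c \<odot>\<^bsub>T\<^esub> cls u = cls (frag_extend k u)"
    using class_frag_extend(1)[OF scalar_extension scalar_extension keys rel u]
    by (simp add: base_change_module_def Let_def k_def)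
  show "Poly_Mapping.keys (frag_extend k u) \<subseteq> carrier S \<times> carrier M"
    by (rule class_frag_extend(2)[OF scalar_extension scalar_extension keys rel u])
qed

lemma smult_pure:
  "c \<in> carrier S \<Longrightarrow> a \<in> carrier S \<Longrightarrow> m \<in> carrier M \<Longrightarrow> c \<odot>\<^bsub>T\<^esub> pure a m = pure (c \<otimes>\<^bsub>S\<^esub> a) m"
  using smult_class(1)[of c "frag_of (a, m)"] by (simp add: pure_tensor_def keys_frag_of)

lemma smult_tensor_closed: "c \<in> carrier S \<Longrightarrow> X \<in> carrier T \<Longrightarrow> c \<odot>\<^bsub>T\<^esub> X \<in> carrier T"
  using smult_class by (auto simp: carrier_tensor)

lemma smult_tensor_add:
  assumes c: "c \<in> carrier S" and X: "X \<in> carrier T" and Y: "Y \<in> carrier T"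
  shows "c \<odot>\<^bsub>T\<^esub> (X \<oplus>\<^bsub>T\<^esub> Y) = c \<odot>\<^bsub>T\<^esub> X \<oplus>\<^bsub>T\<^esub> c \<odot>\<^bsub>T\<^esub> Y"
proof -
  obtain u v where uv: "X = cls u" "Poly_Mapping.keys u \<subseteq> carrier S \<times> carrier M"
      "Y = cls v" "Poly_Mapping.keys v \<subseteq> carrier S \<times> carrier M"
    using X Y by (auto simp: carrier_tensor)
  have "Poly_Mapping.keys (u + v) \<subseteq> carrier S \<times> carrier M"
    using keys_add[of u v] uv by blast
  then show ?thesis
    using uv c by (simp add: add_class smult_class frag_extend_add)
qed

sublocale T: module S T
proof (rule moduleI)
  show "cring S" ..
  show "abelian_group T" ..
  show "c \<odot>\<^bsub>T\<^esub> X \<in> carrier T" if "c \<in> carrier S" "X \<in> carrier T" for c X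
    using that by (rule smult_tensor_closed)
  show "c \<odot>\<^bsub>T\<^esub> (X \<oplus>\<^bsub>T\<^esub> Y) = c \<odot>\<^bsub>T\<^esub> X \<oplus>\<^bsub>T\<^esub> c \<odot>\<^bsub>T\<^esub> Y"
    if "c \<in> carrier S" "X \<in> carrier T" "Y \<in> carrier T" for c X Y
    using that by (rule smult_tensor_add)
  show "(c \<oplus>\<^bsub>S\<^esub> d) \<odot>\<^bsub>T\<^esub> X = c \<odot>\<^bsub>T\<^esub> X \<oplus>\<^bsub>T\<^esub> d \<odot>\<^bsub>T\<^esub> X"
    if "c \<in> carrier S" "d \<in> carrier S" "X \<in> carrier T" for c d X
    using that(3)
  proof (induction rule: tensor_induct)
    case (pure a m)
    then show ?case using that(1,2) by (simp add: smult_pure S.l_distr pure_add_left)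
  next
    case (add X Y)
    then show ?case using that(1,2) by (simp add: smult_tensor_add smult_tensor_closed T.add.m_ac)
  qed
  show "(c \<otimes>\<^bsub>S\<^esub> d) \<odot>\<^bsub>T\<^esub> X = c \<odot>\<^bsub>T\<^esub> (d \<odot>\<^bsub>T\<^esub> X)"
    if "c \<in> carrier S" "d \<in> carrier S" "X \<in> carrier T" for c d X
    using that(3)
  proof (induction rule: tensor_induct)
    case (pure a m)
    then show ?case using that(1,2) by (simp add: smult_pure S.m_assoc)
  next
    case (add X Y)
    then show ?case using that(1,2) by (simp add: smult_tensor_add smult_tensor_closed)
  qed
  show "\<one>\<^bsub>S\<^esub> \<odot>\<^bsub>T\<^esub> X = X" if "X \<in> carrier T" for X
    using that
  proof (induction rule: tensor_induct)
    case (pure a m)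
    then show ?case by (simp add: smult_pure)
  next
    case (add X Y)
    then show ?case by (simp add: smult_tensor_add)
  qed
qed

text \<open>
  The universal property: a \<open>\<phi>\<close>-semilinear map \<open>h\<close> out of \<open>M\<close> is the same as the linear map
  \<open>a \<otimes> m \<mapsto> a h(m)\<close>. The latter comes from the universal properties of free abelian groups and of
  quotients, as the relators go to zero by semilinearity.
\<close>

lemma semilinear_lift:
  assumes P: "module S P" and h: "semilinear_map R \<phi> M P h"
  obtains L where "semilinear_map S (\<lambda>r. r) T P L"
    and "\<And>a m. a \<in> carrier S \<Longrightarrow> m \<in> carrier M \<Longrightarrow> L (pure a m) = a \<odot>\<^bsub>P\<^esub> h m"
proof -
  interpret P: module S P by fact
  note hD = semilinear_mapD[OF h]
  obtain H where H: "H \<in> hom F (add_monoid P)"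
    "\<And>z. z \<in> carrier S \<times> carrier M \<Longrightarrow> H (frag_of z) = (case z of (a, m) \<Rightarrow> a \<odot>\<^bsub>P\<^esub> h m)"
  proof (rule comm_group.free_Abelian_group_universal[OF P.a_comm_group])
    show "(\<lambda>(a, m). a \<odot>\<^bsub>P\<^esub> h m) ` (carrier S \<times> carrier M) \<subseteq> carrier (add_monoid P)"
      using hD by auto
  qed (rule that)
  interpret H: group_hom F "add_monoid P" H
    by (intro group_hom.intro group_hom_axioms.intro H(1) group_free_Abelian_group P.a_group)
  have H_diff: "H (u - v) = H u \<ominus>\<^bsub>P\<^esub> H v" and H_closed: "H u \<in> carrier P"
    if "Poly_Mapping.keys u \<subseteq> carrier S \<times> carrier M" "Poly_Mapping.keys v \<subseteq> carrier S \<times> carrier M" for u v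
    using that H.hom_mult[of u "- v"] H.hom_inv[of v] H.hom_closed[of u]
    by (simp_all add: a_minus_def a_inv_def)
  have rel: "H u = \<zero>\<^bsub>P\<^esub>" if "u \<in> tensor_relators R S \<phi> M" for u
  proof -
    have kd: "Poly_Mapping.keys (frag_of z - frag_of z') \<subseteq> carrier S \<times> carrier M"
      if "z \<in> carrier S \<times> carrier M" "z' \<in> carrier S \<times> carrier M" for z z'
      using keys_diff[of "frag_of z" "frag_of z'"] that by (auto simp: keys_frag_of)
    have minus_add: "(x \<oplus>\<^bsub>P\<^esub> y) \<ominus>\<^bsub>P\<^esub> x \<ominus>\<^bsub>P\<^esub> y = \<zero>\<^bsub>P\<^esub>" if "x \<in> carrier P" "y \<in> carrier P" for x y
    proof -
      have "(x \<oplus>\<^bsub>P\<^esub> y) \<ominus>\<^bsub>P\<^esub> x \<ominus>\<^bsub>P\<^esub> y = (x \<oplus>\<^bsub>P\<^esub> y) \<oplus>\<^bsub>P\<^esub> (\<ominus>\<^bsub>P\<^esub> (x \<oplus>\<^bsub>P\<^esub> y))"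
        using that by (simp add: a_minus_def P.minus_add P.a_assoc)
      then show ?thesis using that by (simp add: P.r_neg)
    qed
    from that consider
      (left) a b m where "u = frag_of (a \<oplus>\<^bsub>S\<^esub> b, m) - frag_of (a, m) - frag_of (b, m)"
        "a \<in> carrier S" "b \<in> carrier S" "m \<in> carrier M"
    | (right) a m n where "u = frag_of (a, m \<oplus>\<^bsub>M\<^esub> n) - frag_of (a, m) - frag_of (a, n)"
        "a \<in> carrier S" "m \<in> carrier M" "n \<in> carrier M"
    | (balance) a r m where "u = frag_of (a \<otimes>\<^bsub>S\<^esub> \<phi> r, m) - frag_of (a, r \<odot>\<^bsub>M\<^esub> m)"
        "a \<in> carrier S" "r \<in> carrier R" "m \<in> carrier M"
      unfolding tensor_relators_def by auto
    then show ?thesis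
    proof cases
      case left
      then show ?thesis
        by (simp add: H_diff kd keys_frag_of H(2) hD P.smult_l_distr minus_add)
    next
      case right
      then show ?thesis
        by (simp add: H_diff kd keys_frag_of H(2) hD P.smult_r_distr minus_add)
    next
      case balance
      then show ?thesis
        by (simp add: H_diff keys_frag_of H(2) hD P.smult_assoc1) (simp add: a_minus_def P.r_neg hD)
    qed
  qed
  have "N \<subseteq> kernel F (add_monoid P) H"
    unfolding tensor_null_def
  proof (intro group.generate_subgroup_incl[OF group_free_Abelian_group] H.subgroup_kernel subsetI)
    show "u \<in> kernel F (add_monoid P) H" if "u \<in> tensor_relators R S \<phi> M" for u
      using rel[OF that] subsetD[OF relators_subset that] by (simp add: kernel_def)
  qed
  then have H_const: "H u = H v"
    if "u \<in> carrier F" "v \<in> carrier F" "N #>\<^bsub>F\<^esub> u = N #>\<^bsub>F\<^esub> v" for u v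
  proof -
    have "u \<in> N #>\<^bsub>F\<^esub> v"
      using that group.rcos_self[OF group_free_Abelian_group that(1) null_subgroup]
      by simp
    then obtain n where "n \<in> N" "u = n + v" unfolding r_coset_def by auto
    moreover have "H n = \<zero>\<^bsub>P\<^esub>" "n \<in> carrier F"
      using \<open>N \<subseteq> kernel F (add_monoid P) H\<close> \<open>n \<in> N\<close> by (auto simp: kernel_def)
    ultimately show ?thesis using H.hom_mult[of n v] that(2) H_closed[of v v] by simp
  qed
  obtain L where L: "L \<in> hom (F Mod N) (add_monoid P)" "\<And>u. u \<in> carrier F \<Longrightarrow> L (N #>\<^bsub>F\<^esub> u) = H u"
    using FactGroup_universal[OF H(1) null_normal H_const] by blast
  have L_pure: "L (pure a m) = a \<odot>\<^bsub>P\<^esub> h m" if "a \<in> carrier S" "m \<in> carrier M" for a m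
    using that L(2)[of "frag_of (a, m)"] H(2)[of "(a, m)"]
    by (simp add: pure_tensor_def tensor_class_def keys_frag_of)
  have L_closed: "L X \<in> carrier P" if "X \<in> carrier T" for X
    using L(1) that unfolding tensor_additive_structure hom_def by auto
  have L_add: "L (X \<oplus>\<^bsub>T\<^esub> Y) = L X \<oplus>\<^bsub>P\<^esub> L Y" if "X \<in> carrier T" "Y \<in> carrier T" for X Y
    using L(1) that unfolding tensor_additive_structure hom_def by auto
  have "L (c \<odot>\<^bsub>T\<^esub> X) = c \<odot>\<^bsub>P\<^esub> L X" if "c \<in> carrier S" "X \<in> carrier T" for c X
    using that(2)
  proof (induction rule: tensor_induct)
    case (pure a m)
    then show ?case using that(1) hD by (simp add: smult_pure L_pure P.smult_assoc1)
  next
    case (add X Y)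
    then show ?case using that(1) by (simp add: T.smult_r_distr P.smult_r_distr L_add L_closed)
  qed
  then have "semilinear_map S (\<lambda>r. r) T P L"
    unfolding semilinear_map_def using L_closed L_add by simp
  with L_pure that show ?thesis by blast
qed

end

lemma base_change_map_linear:
  assumes "scalar_extension R S M \<phi>" and "scalar_extension R S M' \<phi>"
    and h: "semilinear_map R (\<lambda>r. r) M M' h"
  shows "semilinear_map S (\<lambda>r. r) (base_change_module R S \<phi> M) (base_change_module R S \<phi> M')
      (base_change_map R S \<phi> M' h)"
    and "\<And>a m. a \<in> carrier S \<Longrightarrow> m \<in> carrier M \<Longrightarrow>
      base_change_map R S \<phi> M' h (pure_tensor R S \<phi> M a m) = pure_tensor R S \<phi> M' a (h m)"
proof -
  interpret A: scalar_extension R S M \<phi> by fact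
  interpret B: scalar_extension R S M' \<phi> by fact
  note hD = semilinear_mapD[OF h]
  let ?k = "\<lambda>(a, m). frag_of (a, h m)"
  let ?h = "base_change_map R S \<phi> M' h"
  have rel: "frag_extend ?k v \<in> B.N" if "v \<in> tensor_relators R S \<phi> M" for v
  proof (rule B.relator_in_null)
    show "frag_extend ?k v \<in> tensor_relators R S \<phi> M'"
      using that unfolding tensor_relators_def
      by (elim UnE CollectE exE conjE; simp add: frag_extend_diff hD) (use hD(1) in blast)+
  qed
  have keys: "Poly_Mapping.keys (?k (a, m)) \<subseteq> carrier S \<times> carrier M'"
    if "a \<in> carrier S" "m \<in> carrier M" for a m
    using hD that by (simp add: keys_frag_of)
  note fe = class_frag_extend[OF assms(1,2) keys rel]
  have map: "?h (A.cls u) = B.cls (frag_extend ?k u)"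
    if "Poly_Mapping.keys u \<subseteq> carrier S \<times> carrier M" for u
    unfolding base_change_map_def using fe(1)[OF _ _ _ that] by simp
  have keys': "Poly_Mapping.keys (frag_extend ?k u) \<subseteq> carrier S \<times> carrier M'"
    if "Poly_Mapping.keys u \<subseteq> carrier S \<times> carrier M" for u
    using fe(2)[OF _ _ _ that] by simp
  show map_pure: "?h (A.pure a m) = B.pure a (h m)" if "a \<in> carrier S" "m \<in> carrier M" for a m
    using map[of "frag_of (a, m)"] that by (simp add: pure_tensor_def keys_frag_of)
  have closed: "?h X \<in> carrier B.T" if "X \<in> carrier A.T" for X
    using that by (auto simp: A.carrier_tensor map keys')
  have map_add: "?h (X \<oplus>\<^bsub>A.T\<^esub> Y) = ?h X \<oplus>\<^bsub>B.T\<^esub> ?h Y" if "X \<in> carrier A.T" "Y \<in> carrier A.T" for X Y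
  proof -
    obtain u v where uv: "X = A.cls u" "Poly_Mapping.keys u \<subseteq> carrier S \<times> carrier M"
        "Y = A.cls v" "Poly_Mapping.keys v \<subseteq> carrier S \<times> carrier M"
      using \<open>X \<in> _\<close> \<open>Y \<in> _\<close> by (auto simp: A.carrier_tensor)
    have "Poly_Mapping.keys (u + v) \<subseteq> carrier S \<times> carrier M"
      using keys_add[of u v] uv by blast
    then show ?thesis using uv by (simp add: A.add_class B.add_class map keys' frag_extend_add)
  qed
  have "?h (c \<odot>\<^bsub>A.T\<^esub> X) = c \<odot>\<^bsub>B.T\<^esub> ?h X" if "c \<in> carrier S" "X \<in> carrier A.T" for c X
    using that(2)
  proof (induction rule: A.tensor_induct)
    case (pure a m)
    then show ?case using that(1) hD by (simp add: A.smult_pure B.smult_pure map_pure)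
  next
    case (add X Y)
    then show ?case using that(1) by (simp add: A.T.smult_r_distr B.T.smult_r_distr closed map_add)
  qed
  then show "semilinear_map S (\<lambda>r. r) A.T B.T ?h"
    unfolding semilinear_map_def using closed map_add by simp
qed

section \<open>Base change of complexes\<close>

lemma obj_base_change [simp]: "obj (base_change R S \<phi> C) i = base_change_module R S \<phi> (obj C i)"
  and diff_base_change [simp]:
    "diff (base_change R S \<phi> C) i = base_change_map R S \<phi> (obj C (Suc i)) (diff C i)"
  by (simp_all add: base_change_def)

lemma base_change_complex:
  assumes "cring S" and "\<phi> \<in> ring_hom R S" and "cochain_complex R C"
  shows "cochain_complex S (base_change R S \<phi> C)"
proof -
  interpret C: complex_over R C by unfold_locales fact
  interpret S: cring S by fact
  have ext: "scalar_extension R S (obj C i) \<phi>" for i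
    using assms(2) by (intro scalar_extension.intro scalar_extension_axioms.intro assms(1) C.obj.module_axioms
        C.obj.R.cring_axioms)
  interpret T: scalar_extension R S "obj C i" \<phi> for i by (rule ext)
  note lin = base_change_map_linear(1)[OF ext ext C.diff_semilinear]
  show ?thesis
    unfolding cochain_complex_def obj_base_change diff_base_change
  proof (intro conjI allI ballI lin T.T.module_axioms)
    fix i X assume "X \<in> carrier (base_change_module R S \<phi> (obj C i))"
    then show "base_change_map R S \<phi> (obj C (Suc (Suc i))) (diff C (Suc i))
        (base_change_map R S \<phi> (obj C (Suc i)) (diff C i) X) =
        \<zero>\<^bsub>base_change_module R S \<phi> (obj C (Suc (Suc i)))\<^esub>"
    proof (induction rule: T.tensor_induct)
      case (pure a m)
      then show ?case
        by (simp add: base_change_map_linear(2)[OF ext ext C.diff_semilinear] C.diff_diff T.pure_zero_right)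
    next
      case (add X Y)
      then show ?case by (simp add: semilinear_mapD(1,2)[OF lin])
    qed
  qed
qed

text \<open>
  The universal property in every degree; compatibility with the differentials need only be tested on
  pure tensors.
\<close>

lemma semilinear_cochain_map_lift:
  assumes S: "cring S" and \<phi>: "\<phi> \<in> ring_hom R S" and f: "semilinear_cochain_map R S \<phi> C D f"
  obtains L where "cochain_map S (base_change R S \<phi> C) D L"
    and "\<And>i a m. a \<in> carrier S \<Longrightarrow> m \<in> carrier (obj C i) \<Longrightarrow>
      L i (pure_tensor R S \<phi> (obj C i) a m) = a \<odot>\<^bsub>obj D i\<^esub> f i m"
proof -
  interpret C: complex_over R C
    using f unfolding semilinear_cochain_map_def by unfold_locales blast
  interpret D: complex_over S D
    using f unfolding semilinear_cochain_map_def by unfold_locales blast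
  have f_lin: "\<And>j. semilinear_map R \<phi> (obj C j) (obj D j) (f j)"
    and f_diff: "\<And>j x. x \<in> carrier (obj C j) \<Longrightarrow> f (Suc j) (diff C j x) = diff D j (f j x)"
    using f unfolding semilinear_cochain_map_def by blast+
  have ext: "scalar_extension R S (obj C i) \<phi>" for i
    using \<phi> by (intro scalar_extension.intro scalar_extension_axioms.intro S C.obj.module_axioms
        C.obj.R.cring_axioms)
  interpret T: scalar_extension R S "obj C i" \<phi> for i by (rule ext)
  have "\<forall>i. \<exists>L. semilinear_map S (\<lambda>r. r) (T.T i) (obj D i) L \<and>
      (\<forall>a\<in>carrier S. \<forall>m\<in>carrier (obj C i). L (T.pure i a m) = a \<odot>\<^bsub>obj D i\<^esub> f i m)"
    using T.semilinear_lift[OF D.obj.module_axioms f_lin] by metis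
  then obtain L where L: "\<And>i. semilinear_map S (\<lambda>r. r) (T.T i) (obj D i) (L i)"
    "\<And>i a m. a \<in> carrier S \<Longrightarrow> m \<in> carrier (obj C i) \<Longrightarrow> L i (T.pure i a m) = a \<odot>\<^bsub>obj D i\<^esub> f i m"
    by metis
  let ?d = "\<lambda>i. base_change_map R S \<phi> (obj C (Suc i)) (diff C i)"
  note d_lin = base_change_map_linear(1)[OF ext ext C.diff_semilinear]
  have "L (Suc i) (?d i X) = diff D i (L i X)" if "X \<in> carrier (T.T i)" for i X
    using that
  proof (induction rule: T.tensor_induct)
    case (pure a m)
    then show ?case
      using semilinear_mapD(1)[OF f_lin]
      by (simp add: base_change_map_linear(2)[OF ext ext C.diff_semilinear] L(2) f_diff D.diff_smult)
  next
    case (add X Y)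
    then show ?case by (simp add: semilinear_mapD(1,2)[OF d_lin] semilinear_mapD(1,2)[OF L(1)])
  qed
  then have "cochain_map S (base_change R S \<phi> C) D L"
    unfolding semilinear_cochain_map_def
    using base_change_complex[OF S \<phi> C.complex] D.complex L(1) by simp
  with L(2) that show ?thesis by blast
qed

section \<open>Coefficients of polynomials\<close>

context UP_cring
begin

text \<open>
  A polynomial in \<^const>\<open>UP\<close> is its coefficient function.
\<close>

lemma polynomial_of_coeffs:
  assumes c: "\<And>n. c n \<in> carrier R" and N: "\<And>n. n > N \<Longrightarrow> c n = \<zero>"
  obtains g where "g \<in> carrier P" "\<And>n. coeff P g n = c n"
proof -
  have "c \<in> up R" using c N by (intro mem_upI) auto
  then show ?thesis using that[of c] by (simp add: P_def UP_def)
qed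

lemma finsum_monom_closed:
  assumes "\<And>k. k \<in> A \<Longrightarrow> c k \<in> carrier R"
  shows "(\<Oplus>\<^bsub>P\<^esub>k\<in>A. monom P (c k) (e k)) \<in> carrier P"
  using assms by (intro P.finsum_closed) auto

text \<open>
  The exponents \<open>e\<close> may collide where the coefficients vanish: in \<^const>\<open>nabla\<close> the exponents
  \<open>n - 1\<close> agree for \<open>n = 0\<close> and \<open>n = 1\<close>, and the term for \<open>n = 0\<close> is zero.
\<close>

lemma coeff_finsum_monom:
  assumes A: "finite A" and c: "\<And>k. k \<in> A \<Longrightarrow> c k \<in> carrier R" and j: "j \<in> A"
    and only: "\<And>k. k \<in> A \<Longrightarrow> e k = e j \<Longrightarrow> k \<noteq> j \<Longrightarrow> c k = \<zero>"
  shows "coeff P (\<Oplus>\<^bsub>P\<^esub>k\<in>A. monom P (c k) (e k)) (e j) = c j"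
proof -
  have "coeff P (\<Oplus>\<^bsub>P\<^esub>k\<in>A. monom P (c k) (e k)) (e j) = (\<Oplus>k\<in>A. coeff P (monom P (c k) (e k)) (e j))"
    using c by (intro coeff_finsum[OF A]) auto
  also have "\<dots> = (\<Oplus>k\<in>A. if j = k then c k else \<zero>)"
    using c only by (intro R.finsum_cong') auto
  also have "\<dots> = c j"
    using j A c by (intro R.finsum_singleton) auto
  finally show ?thesis .
qed

lemma coeff_finsum_monom_0:
  assumes A: "finite A" and c: "\<And>k. k \<in> A \<Longrightarrow> c k \<in> carrier R"
    and only: "\<And>k. k \<in> A \<Longrightarrow> e k = n \<Longrightarrow> c k = \<zero>"
  shows "coeff P (\<Oplus>\<^bsub>P\<^esub>k\<in>A. monom P (c k) (e k)) n = \<zero>"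
proof -
  have "coeff P (\<Oplus>\<^bsub>P\<^esub>k\<in>A. monom P (c k) (e k)) n = (\<Oplus>k\<in>A. coeff P (monom P (c k) (e k)) n)"
    using c by (intro coeff_finsum[OF A]) auto
  also have "\<dots> = (\<Oplus>k\<in>A. \<zero>)"
    using c only by (intro R.finsum_cong') auto
  finally show ?thesis by simp
qed

end

section \<open>The s-de Rham complex\<close>

context n_series_cring
begin

sublocale UP: UP_cring R "UP R"
  by unfold_locales simp

abbreviation "cf \<equiv> coeff (UP R)"

lemma coeff_nabla:
  assumes g: "g \<in> carrier (UP R)"
  shows "cf (nabla R s g) n = s (Suc n) \<otimes> cf g (Suc n)"
proof (cases "Suc n \<le> deg R g")
  case True
  have "cf (nabla R s g) (Suc n - 1) = s (Suc n) \<otimes> cf g (Suc n)"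
    unfolding nabla_def
  proof (rule UP.coeff_finsum_monom[where e = "\<lambda>n. n - 1"])
    fix k assume "k - 1 = Suc n - 1" "k \<noteq> Suc n"
    then have "k = 0" by arith
    then show "s k \<otimes> cf g k = \<zero>" using g by simp
  qed (use True g in auto)
  then show ?thesis by simp
next
  case False
  have "cf (nabla R s g) n = \<zero>"
    unfolding nabla_def
  proof (rule UP.coeff_finsum_monom_0)
    fix k assume "k \<in> {..deg R g}" "k - 1 = n"
    then have "k = 0" using False by auto
    then show "s k \<otimes> cf g k = \<zero>" using g by simp
  qed (use g in auto)
  then show ?thesis using False g UP.deg_aboveD[of g "Suc n"] by simp
qed

lemma nabla_closed: "g \<in> carrier (UP R) \<Longrightarrow> nabla R s g \<in> carrier (UP R)"
  unfolding nabla_def by (intro UP.finsum_monom_closed) auto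

lemma nabla_semilinear: "semilinear_map R (\<lambda>r. r) (UP R) (UP R) (nabla R s)"
  unfolding semilinear_map_def
  by (auto intro!: nabla_closed UP.up_eqI simp: coeff_nabla r_distr m_lcomm nabla_closed)

lemma UP_module: "module R (UP R)" ..

lemma obj_s_deRham:
  "i \<le> 1 \<Longrightarrow> obj (s_deRham R s) i = UP R"
  "i > 1 \<Longrightarrow> carrier (obj (s_deRham R s) i) = {\<zero>\<^bsub>UP R\<^esub>}"
  "ring.add (obj (s_deRham R s) i) = ring.add (UP R)"
  "ring.zero (obj (s_deRham R s) i) = ring.zero (UP R)"
  "smult (obj (s_deRham R s) i) = smult (UP R)"
  by (simp_all add: s_deRham_def)

lemma diff_s_deRham: "diff (s_deRham R s) i = (if i = 0 then nabla R s else (\<lambda>_. \<zero>\<^bsub>UP R\<^esub>))"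
  by (simp add: s_deRham_def)

lemma zero_module: "module R (UP R\<lparr>carrier := {\<zero>\<^bsub>UP R\<^esub>}\<rparr>)"
  by (intro submodule.submodule_is_module[OF UP.submoduleI] UP_module) auto

lemma s_deRham_complex: "cochain_complex R (s_deRham R s)"
proof -
  have "module R (obj (s_deRham R s) i)" for i
    using UP_module zero_module by (simp add: s_deRham_def)
  moreover have "semilinear_map R (\<lambda>r. r) (obj (s_deRham R s) i) (obj (s_deRham R s) (Suc i)) (diff (s_deRham R s) i)" for i
    using nabla_semilinear
    by (cases "i = 0") (auto simp: semilinear_map_def obj_s_deRham diff_s_deRham s_deRham_def)
  ultimately show ?thesis
    unfolding cochain_complex_def by (simp add: diff_s_deRham obj_s_deRham)
qed

end

section \<open>The Frobenius map on the s-de Rham complex\<close>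

locale frobenius_n_series = n_series_cring +
  fixes \<phi> :: "'a \<Rightarrow> 'a" and p :: nat
  assumes \<phi>: "\<phi> \<in> ring_hom R R" and p_pos: "p > 0"
    and \<phi>_s: "\<And>n. s p \<otimes> \<phi> (s n) = s (n * p)"
begin

lemma phi_closed [simp]: "a \<in> carrier R \<Longrightarrow> \<phi> a \<in> carrier R"
  by (rule ring_hom_closed[OF \<phi>])

lemma phi_zero [simp]: "\<phi> \<zero> = \<zero>"
  by (rule ring_hom_zero[OF \<phi>]) (rule ring_axioms)+

lemma frob_subst_ring_hom: "frob_subst R \<phi> p \<in> ring_hom (UP R) (UP R)"
proof -
  have R: "cring R" by unfold_locales
  have h: "(\<lambda>r. monom (UP R) (\<phi> r) 0) \<in> ring_hom R (UP R)"
    using ring_hom_trans[OF \<phi> UP.const_ring_hom] unfolding comp_def .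
  have E: "UP_pre_univ_prop R (UP R) (\<lambda>r. monom (UP R) (\<phi> r) 0)"
    by (intro UP_pre_univ_prop.intro ring_hom_cring.intro ring_hom_cring_axioms.intro UP_cring.intro
        h R UP.UP_cring)
  show ?thesis
    unfolding frob_subst_def by (rule UP_pre_univ_prop.eval_ring_hom[OF E]) simp
qed

lemma frob_subst_smult:
  assumes "r \<in> carrier R" "g \<in> carrier (UP R)"
  shows "frob_subst R \<phi> p (r \<odot>\<^bsub>UP R\<^esub> g) = \<phi> r \<odot>\<^bsub>UP R\<^esub> frob_subst R \<phi> p g"
proof -
  have "frob_subst R \<phi> p (r \<odot>\<^bsub>UP R\<^esub> g) = frob_subst R \<phi> p (monom (UP R) r 0 \<otimes>\<^bsub>UP R\<^esub> g)"
    using assms by (simp add: UP.monom_mult_is_smult)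
  also have "\<dots> = monom (UP R) (\<phi> r) 0 \<otimes>\<^bsub>UP R\<^esub> frob_subst R \<phi> p g"
    using assms ring_hom_mult[OF frob_subst_ring_hom, of "monom (UP R) r 0" g] frob_subst_monom[OF \<phi>, of r p 0]
    by simp
  finally show ?thesis
    using assms ring_hom_closed[OF frob_subst_ring_hom] by (simp add: UP.monom_mult_is_smult)
qed

lemma Phi_semilinear: "i \<le> 1 \<Longrightarrow> semilinear_map R \<phi> (UP R) (UP R) (Phi R s \<phi> p i)"
  unfolding semilinear_map_def Phi_def
  using ring_hom_closed[OF frob_subst_ring_hom] ring_hom_add[OF frob_subst_ring_hom]
  by (auto simp: frob_subst_smult UP.P.l_distr UP.UP_smult_assoc2)

text \<open>
  The exponent \<open>p k + i (p - 1)\<close> treats both degrees at once: \<open>y\<^sup>k\<close> goes to \<open>x\<^sup>p\<^sup>k\<close> and \<open>y\<^sup>k dy\<close> to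
  \<open>s(p) x\<^sup>p\<^sup>k\<^sup>+\<^sup>p\<^sup>-\<^sup>1 dx\<close>.
\<close>

lemma Phi_monom:
  assumes "i \<le> 1" "a \<in> carrier R"
  shows "Phi R s \<phi> p i (monom (UP R) a k) = monom (UP R) (\<phi> a \<otimes> s p [^] i) (p * k + i * (p - 1))"
proof (cases "i = 0")
  case True
  then show ?thesis using assms by (simp add: Phi_def frob_subst_monom[OF \<phi>])
next
  case False
  then have "i = 1" using assms by simp
  then show ?thesis using assms by (simp add: Phi_def frob_subst_monom[OF \<phi>])
qed

text \<open>
  Give \<open>x\<^sup>n\<close> and \<open>x\<^sup>n\<^sup>-\<^sup>1 dx\<close> the weight \<open>n\<close>; the differential preserves it. The exponent \<open>n\<close> in degree \<open>i\<close>
  has weight \<open>n + i\<close>, and the image of \<^const>\<open>Phi\<close> lives in the weights divisible by \<open>p\<close>.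
\<close>

lemma exponent_iff:
  assumes "i \<le> 1"
  shows "p dvd n + i \<longleftrightarrow> (\<exists>k. n = p * k + i * (p - 1))"
proof (cases "i = 0")
  case True
  then show ?thesis by (auto simp: dvd_def)
next
  case False
  then have i: "i = 1" using assms by simp
  show ?thesis
  proof
    assume "p dvd n + i"
    then obtain m where m: "n + 1 = p * m" unfolding i dvd_def by blast
    then obtain k where "m = Suc k" by (cases m) auto
    then have "n = p * k + i * (p - 1)" using m p_pos i by simp
    then show "\<exists>k. n = p * k + i * (p - 1)" ..
  next
    assume "\<exists>k. n = p * k + i * (p - 1)"
    then obtain k where "n = p * k + (p - 1)" unfolding i by auto
    then have "n + i = p * Suc k" using p_pos i by simp
    then show "p dvd n + i" by simp
  qed
qed

lemma Phi_expansion: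
  assumes i: "i \<le> 1" and g: "g \<in> carrier (UP R)"
  shows "Phi R s \<phi> p i g =
    (\<Oplus>\<^bsub>UP R\<^esub>k\<in>{..deg R g}. monom (UP R) (\<phi> (cf g k) \<otimes> s p [^] i) (p * k + i * (p - 1)))"
proof -
  interpret Phi: abelian_group_hom "UP R" "UP R" "Phi R s \<phi> p i"
    by (rule semilinear_map_hom[OF Phi_semilinear[OF i] UP.P.abelian_group_axioms UP.P.abelian_group_axioms])
  have "Phi R s \<phi> p i g = Phi R s \<phi> p i (\<Oplus>\<^bsub>UP R\<^esub>k\<in>{..deg R g}. monom (UP R) (cf g k) k)"
    using UP.up_repr[OF g] by simp
  also have "\<dots> = (\<Oplus>\<^bsub>UP R\<^esub>k\<in>{..deg R g}. Phi R s \<phi> p i (monom (UP R) (cf g k) k))"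
    using g by (intro Phi.hom_finsum) auto
  also have "\<dots> = (\<Oplus>\<^bsub>UP R\<^esub>k\<in>{..deg R g}. monom (UP R) (\<phi> (cf g k) \<otimes> s p [^] i) (p * k + i * (p - 1)))"
    using g i by (intro UP.P.finsum_cong') (auto simp: Phi_monom)
  finally show ?thesis .
qed

lemma coeff_Phi:
  assumes i: "i \<le> 1" and g: "g \<in> carrier (UP R)"
  shows "cf (Phi R s \<phi> p i g) (p * k + i * (p - 1)) = \<phi> (cf g k) \<otimes> s p [^] i"
proof (cases "k \<le> deg R g")
  case True
  show ?thesis
    unfolding Phi_expansion[OF i g]
    by (rule UP.coeff_finsum_monom) (use True g p_pos in auto)
next
  case False
  then have "cf g k = \<zero>" using g by (intro UP.deg_aboveD) auto
  moreover have "cf (Phi R s \<phi> p i g) (p * k + i * (p - 1)) = \<zero>"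
    unfolding Phi_expansion[OF i g]
    by (rule UP.coeff_finsum_monom_0) (use False g p_pos in auto)
  ultimately show ?thesis by simp
qed

lemma coeff_Phi_0:
  assumes i: "i \<le> 1" and g: "g \<in> carrier (UP R)" and n: "\<not> p dvd n + i"
  shows "cf (Phi R s \<phi> p i g) n = \<zero>"
  unfolding Phi_expansion[OF i g]
  by (rule UP.coeff_finsum_monom_0) (use g n exponent_iff[OF i, of n] in auto)

lemma Phi_closed: "i \<le> 1 \<Longrightarrow> g \<in> carrier (UP R) \<Longrightarrow> Phi R s \<phi> p i g \<in> carrier (UP R)"
  by (rule semilinear_mapD(1)[OF Phi_semilinear])

text \<open>
  In weight \<open>p (k + 1)\<close> this is the relation \<open>s(p) \<phi>(s(k + 1)) = s(p (k + 1))\<close>; in the weights not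
  divisible by \<open>p\<close> both sides vanish.
\<close>

lemma Phi_nabla:
  assumes g: "g \<in> carrier (UP R)"
  shows "Phi R s \<phi> p 1 (nabla R s g) = nabla R s (Phi R s \<phi> p 0 g)"
proof (rule UP.up_eqI)
  fix n
  show "cf (Phi R s \<phi> p 1 (nabla R s g)) n = cf (nabla R s (Phi R s \<phi> p 0 g)) n"
  proof (cases "p dvd n + 1")
    case True
    then obtain k where n: "n = p * k + 1 * (p - 1)" using exponent_iff[of 1 n] by auto
    then have Suc_n: "Suc n = p * Suc k + 0 * (p - 1)" using p_pos by simp
    have "cf (Phi R s \<phi> p 1 (nabla R s g)) n = \<phi> (s (Suc k) \<otimes> cf g (Suc k)) \<otimes> s p"
      using g coeff_Phi[of 1 "nabla R s g" k] by (simp add: n nabla_closed coeff_nabla)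
    also have "\<dots> = (s p \<otimes> \<phi> (s (Suc k))) \<otimes> \<phi> (cf g (Suc k))"
      using g by (simp add: ring_hom_mult[OF \<phi>] m_ac)
    also have "\<dots> = s (Suc n) \<otimes> \<phi> (cf g (Suc k))"
      unfolding \<phi>_s Suc_n by (simp add: mult.commute)
    also have "\<dots> = s (Suc n) \<otimes> cf (Phi R s \<phi> p 0 g) (Suc n)"
      using coeff_Phi[of 0 g "Suc k"] g unfolding Suc_n by simp
    finally show ?thesis using g by (simp add: coeff_nabla Phi_closed)
  next
    case False
    then show ?thesis
      using coeff_Phi_0[of 1 "nabla R s g" n] coeff_Phi_0[of 0 g "Suc n"] g
      by (simp add: coeff_nabla Phi_closed nabla_closed)
  qed
qed (use g in \<open>auto intro!: Phi_closed nabla_closed\<close>)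

lemma Phi_cochain_map: "semilinear_cochain_map R R \<phi> (s_deRham R s) (s_deRham R s) (Phi R s \<phi> p)"
  unfolding semilinear_cochain_map_def
proof (intro conjI allI ballI s_deRham_complex)
  fix i
  show "semilinear_map R \<phi> (obj (s_deRham R s) i) (obj (s_deRham R s) i) (Phi R s \<phi> p i)"
    using Phi_semilinear[of i]
    by (cases "i \<le> 1") (auto simp: obj_s_deRham semilinear_map_def Phi_def)
  fix g assume g: "g \<in> carrier (obj (s_deRham R s) i)"
  show "Phi R s \<phi> p (Suc i) (diff (s_deRham R s) i g) = diff (s_deRham R s) i (Phi R s \<phi> p i g)"
    using g Phi_nabla[of g] by (cases "i = 0") (auto simp: diff_s_deRham obj_s_deRham Phi_def)
qed

lemma Phi_cochain_map_eta:
  "semilinear_cochain_map R R \<phi> (s_deRham R s) (eta R (s p) (s_deRham R s)) (Phi R s \<phi> p)"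
proof (rule semilinear_cochain_map_into_eta[OF Phi_cochain_map s_closed])
  fix i g assume g: "g \<in> carrier (obj (s_deRham R s) i)"
  consider "i = 0" | "i = 1" | "i > 1" by linarith
  then show "\<exists>y\<in>carrier (obj (s_deRham R s) i). Phi R s \<phi> p i g = (s p [^] i) \<odot>\<^bsub>obj (s_deRham R s) i\<^esub> y"
  proof cases
    case 1
    then show ?thesis using g Phi_closed[of 0 g] by (auto simp: obj_s_deRham)
  next
    case 2
    have fg: "frob_subst R \<phi> p g \<in> carrier (UP R)"
      using g 2 ring_hom_closed[OF frob_subst_ring_hom] by (simp add: obj_s_deRham)
    have "monom (UP R) (s p) (p - 1) = s p \<odot>\<^bsub>UP R\<^esub> monom (UP R) \<one> (p - 1)"
      by (simp add: UP.monom_mult_smult[symmetric])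
    then have "Phi R s \<phi> p i g = s p \<odot>\<^bsub>UP R\<^esub> (monom (UP R) \<one> (p - 1) \<otimes>\<^bsub>UP R\<^esub> frob_subst R \<phi> p g)"
      using fg 2 by (simp add: Phi_def UP.P.m_comm[of "frob_subst R \<phi> p g"] UP.UP_smult_assoc2)
    then show ?thesis using 2 fg by (auto simp: obj_s_deRham)
  next
    case 3
    then show ?thesis by (simp add: obj_s_deRham Phi_def)
  qed
qed

end

section \<open>The linearised Frobenius map\<close>

context frobenius_n_series
begin

abbreviation "T \<equiv> base_change_module R R \<phi> (UP R)"
abbreviation "pt \<equiv> pure_tensor R R \<phi> (UP R)"

sublocale ext: scalar_extension R R "UP R" \<phi>
  by (intro scalar_extension.intro scalar_extension_axioms.intro \<phi> UP_module cring_axioms)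

text \<open>
  The monomials \<open>y\<^sup>k\<close> generate \<open>R \<otimes> R[y]\<close> over \<open>R\<close>. That the same coefficients serve every upper bound
  \<open>M\<close> beyond some \<open>N\<close> allows two expansions to be added termwise.
\<close>

lemma tensor_expansion:
  assumes "X \<in> carrier T"
  shows "\<exists>N a. (\<forall>k. a k \<in> carrier R) \<and>
    (\<forall>M\<ge>N. X = (\<Oplus>\<^bsub>T\<^esub>k\<in>{..M}. pt (a k) (monom (UP R) \<one> k)))"
  using assms
proof (induction rule: ext.tensor_induct)
  case (pure a g)
  interpret pa: abelian_group_hom "UP R" T "pt a"
    by (intro abelian_group_homI group_hom.intro group_hom_axioms.intro abelian_group.a_group
        UP.P.abelian_group_axioms ext.tensor_abelian_group)
      (use pure(1) in \<open>auto simp: hom_def ext.pure_add_right\<close>)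
  have expansion: "pt a g = (\<Oplus>\<^bsub>T\<^esub>k\<in>{..M}. pt (a \<otimes> \<phi> (cf g k)) (monom (UP R) \<one> k))" if "M \<ge> deg R g" for M
  proof -
    have "pt a g = pt a (\<Oplus>\<^bsub>UP R\<^esub>k\<in>{..M}. monom (UP R) (cf g k) k)"
      using UP.up_repr_le[OF that pure(2)] by simp
    also have "\<dots> = (\<Oplus>\<^bsub>T\<^esub>k\<in>{..M}. pt a (monom (UP R) (cf g k) k))"
      using pure by (intro pa.hom_finsum) auto
    also have "\<dots> = (\<Oplus>\<^bsub>T\<^esub>k\<in>{..M}. pt (a \<otimes> \<phi> (cf g k)) (monom (UP R) \<one> k))"
    proof (intro ext.T.finsum_cong')
      fix k
      have "monom (UP R) (cf g k) k = cf g k \<odot>\<^bsub>UP R\<^esub> monom (UP R) \<one> k"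
        using pure UP.monom_mult_smult[of "cf g k" \<one> k] by simp
      then show "pt a (monom (UP R) (cf g k) k) = pt (a \<otimes> \<phi> (cf g k)) (monom (UP R) \<one> k)"
        using pure by (simp add: ext.pure_smult)
    qed (use pure in auto)
    finally show ?thesis .
  qed
  have closed: "a \<otimes> \<phi> (cf g k) \<in> carrier R" for k using pure by simp
  show ?case
    by (rule exI[of _ "deg R g"], rule exI[of _ "\<lambda>k. a \<otimes> \<phi> (cf g k)"])
      (intro conjI allI impI closed expansion)
next
  case (add X Y)
  from add.IH(1) obtain N a where a: "\<forall>k. a k \<in> carrier R"
    and X: "\<forall>M\<ge>N. X = (\<Oplus>\<^bsub>T\<^esub>k\<in>{..M}. pt (a k) (monom (UP R) \<one> k))"
    by (elim exE conjE)
  from add.IH(2) obtain N' b where b: "\<forall>k. b k \<in> carrier R"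
    and Y: "\<forall>M\<ge>N'. Y = (\<Oplus>\<^bsub>T\<^esub>k\<in>{..M}. pt (b k) (monom (UP R) \<one> k))"
    by (elim exE conjE)
  note ab = a[rule_format] b[rule_format]
  have expansion: "X \<oplus>\<^bsub>T\<^esub> Y = (\<Oplus>\<^bsub>T\<^esub>k\<in>{..M}. pt (a k \<oplus> b k) (monom (UP R) \<one> k))" if "M \<ge> max N N'" for M
  proof -
    have "(\<Oplus>\<^bsub>T\<^esub>k\<in>{..M}. pt (a k \<oplus> b k) (monom (UP R) \<one> k))
        = (\<Oplus>\<^bsub>T\<^esub>k\<in>{..M}. pt (a k) (monom (UP R) \<one> k) \<oplus>\<^bsub>T\<^esub> pt (b k) (monom (UP R) \<one> k))"
      by (intro ext.T.finsum_cong') (auto simp: ab ext.pure_add_left)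
    also have "\<dots> = (\<Oplus>\<^bsub>T\<^esub>k\<in>{..M}. pt (a k) (monom (UP R) \<one> k)) \<oplus>\<^bsub>T\<^esub>
        (\<Oplus>\<^bsub>T\<^esub>k\<in>{..M}. pt (b k) (monom (UP R) \<one> k))"
      by (intro ext.T.finsum_addf) (auto simp: ab)
    also have "\<dots> = X \<oplus>\<^bsub>T\<^esub> Y"
      using X[rule_format, of M] Y[rule_format, of M] that by simp
    finally show ?thesis ..
  qed
  have closed: "a k \<oplus> b k \<in> carrier R" for k using ab by simp
  show ?case
    by (rule exI[of _ "max N N'"], rule exI[of _ "\<lambda>k. a k \<oplus> b k"])
      (intro conjI allI impI closed expansion)
qed

lemma tensor_expansionE:
  assumes "X \<in> carrier T"
  obtains N a where "\<And>k. a k \<in> carrier R" "X = (\<Oplus>\<^bsub>T\<^esub>k\<in>{..N}. pt (a k) (monom (UP R) \<one> k))"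
proof -
  from tensor_expansion[OF assms] obtain N a where a: "\<forall>k. a k \<in> carrier R"
    and X: "\<forall>M\<ge>N. X = (\<Oplus>\<^bsub>T\<^esub>k\<in>{..M}. pt (a k) (monom (UP R) \<one> k))"
    by (elim exE conjE)
  show thesis by (rule that[OF a[rule_format] X[rule_format, OF order_refl]])
qed

end

text \<open>
  The linear map \<open>a \<otimes> g \<mapsto> a \<Phi>(g)\<close> in degree \<open>i\<close>, with values in all of \<open>R[x]\<close>. It is injective, and its
  image consists of the multiples of \<open>s(p)\<^sup>i\<close> that are concentrated in weights divisible by \<open>p\<close>.
\<close>

locale linearised_Phi = frobenius_n_series +
  fixes i :: nat and \<Psi> :: "('a \<times> (nat \<Rightarrow> 'a) \<Rightarrow>\<^sub>0 int) set \<Rightarrow> nat \<Rightarrow> 'a"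
  assumes i: "i \<le> 1"
    and \<Psi>_linear: "semilinear_map R (\<lambda>r. r) T (UP R) \<Psi>"
    and \<Psi>_pure: "\<And>a g. a \<in> carrier R \<Longrightarrow> g \<in> carrier (UP R) \<Longrightarrow>
      \<Psi> (pt a g) = a \<odot>\<^bsub>UP R\<^esub> Phi R s \<phi> p i g"
begin

sublocale \<Psi>: abelian_group_hom T "UP R" \<Psi>
  by (rule semilinear_map_hom[OF \<Psi>_linear ext.tensor_abelian_group UP.P.abelian_group_axioms])

lemma \<Psi>_expansion:
  assumes a: "\<And>k. a k \<in> carrier R"
  shows "\<Psi> (\<Oplus>\<^bsub>T\<^esub>k\<in>{..N}. pt (a k) (monom (UP R) \<one> k)) =
    (\<Oplus>\<^bsub>UP R\<^esub>k\<in>{..N}. monom (UP R) (a k \<otimes> s p [^] i) (p * k + i * (p - 1)))"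
proof -
  have "\<Psi> (\<Oplus>\<^bsub>T\<^esub>k\<in>{..N}. pt (a k) (monom (UP R) \<one> k)) =
      (\<Oplus>\<^bsub>UP R\<^esub>k\<in>{..N}. \<Psi> (pt (a k) (monom (UP R) \<one> k)))"
    using a by (intro \<Psi>.hom_finsum) auto
  also have "\<dots> = (\<Oplus>\<^bsub>UP R\<^esub>k\<in>{..N}. monom (UP R) (a k \<otimes> s p [^] i) (p * k + i * (p - 1)))"
    using a ring_hom_one[OF \<phi>]
    by (intro UP.P.finsum_cong') (auto simp: \<Psi>_pure Phi_monom[OF i] UP.monom_mult_smult[symmetric])
  finally show ?thesis .
qed

lemma coeff_\<Psi>_0:
  assumes X: "X \<in> carrier T" and n: "\<not> p dvd n + i"
  shows "cf (\<Psi> X) n = \<zero>"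
proof -
  obtain N a where a: "\<And>k. a k \<in> carrier R"
    "X = (\<Oplus>\<^bsub>T\<^esub>k\<in>{..N}. pt (a k) (monom (UP R) \<one> k))"
    using X by (rule tensor_expansionE) (rule that)
  have "p * k + i * (p - 1) \<noteq> n" for k using n exponent_iff[OF i, of n] by blast
  then show ?thesis
    unfolding a(2) \<Psi>_expansion[OF a(1)]
    by (intro UP.coeff_finsum_monom_0) (simp_all add: a(1))
qed

lemma s_pow_cancel:
  assumes b: "b \<in> carrier R" and "b \<otimes> s p [^] i = \<zero>"
  shows "b = \<zero>"
proof (cases "i = 0")
  case True
  then show ?thesis using assms by simp
next
  case False
  then have "i = 1" using i by simp
  then have "b \<otimes> s p = \<zero>" using assms(2) by simp
  then have "s p \<otimes> b = \<zero>" using m_comm[OF b s_closed] by simp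
  then show ?thesis using s_cancel[of p b] p_pos b by simp
qed

text \<open>
  Distinct \<open>y\<^sup>k\<close> go to \<open>s(p)\<^sup>i\<close> times distinct monomials, and \<open>s(p)\<close> is not a zero divisor.
\<close>

lemma \<Psi>_injective:
  assumes X: "X \<in> carrier T" and "\<Psi> X = \<zero>\<^bsub>UP R\<^esub>"
  shows "X = \<zero>\<^bsub>T\<^esub>"
proof -
  obtain N a where a: "\<And>k. a k \<in> carrier R"
    "X = (\<Oplus>\<^bsub>T\<^esub>k\<in>{..N}. pt (a k) (monom (UP R) \<one> k))"
    using X by (rule tensor_expansionE) (rule that)
  have "a k = \<zero>" if "k \<in> {..N}" for k
  proof -
    have "cf (\<Psi> X) (p * k + i * (p - 1)) = a k \<otimes> s p [^] i"
      unfolding a(2) \<Psi>_expansion[OF a(1)]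
      by (rule UP.coeff_finsum_monom) (use a(1) that p_pos in auto)
    then show ?thesis using assms(2) a(1) s_pow_cancel[of "a k"] by simp
  qed
  then have "X = (\<Oplus>\<^bsub>T\<^esub>k\<in>{..N}. \<zero>\<^bsub>T\<^esub>)"
    unfolding a(2) by (intro ext.T.finsum_cong') (auto simp: ext.pure_zero_left)
  then show ?thesis by simp
qed

lemma mem_image_\<Psi>:
  assumes f: "f \<in> carrier (UP R)" and y: "y \<in> carrier (UP R)" and fy: "f = (s p [^] i) \<odot>\<^bsub>UP R\<^esub> y"
    and supp: "\<And>n. \<not> p dvd n + i \<Longrightarrow> cf f n = \<zero>"
  shows "f \<in> \<Psi> ` carrier T"
proof -
  let ?e = "\<lambda>k. p * k + i * (p - 1)"
  \<comment> \<open>The preimage collects the coefficients of \<open>y\<close> at the exponents in the image; since \<open>k\<close> is at most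
    its exponent, \<open>k \<le> deg R f\<close> is a sufficient range.\<close>
  let ?X = "\<Oplus>\<^bsub>T\<^esub>k\<in>{..deg R f}. pt (cf y (?e k)) (monom (UP R) \<one> k)"
  have a: "cf y (?e k) \<in> carrier R" for k using y by simp
  have X: "?X \<in> carrier T" using y by (intro ext.T.finsum_closed) auto
  have "\<Psi> ?X = f"
  proof (rule UP.up_eqI)
    show "\<Psi> ?X \<in> carrier (UP R)" using X by simp
    fix n
    show "cf (\<Psi> ?X) n = cf f n"
    proof (cases "p dvd n + i")
      case False
      then show ?thesis using supp coeff_\<Psi>_0[OF X] by simp
    next
      case True
      then obtain k where k: "n = ?e k" using exponent_iff[OF i] by blast
      show ?thesis
      proof (cases "k \<le> deg R f")
        case True
        have "cf (\<Psi> ?X) (?e k) = cf y (?e k) \<otimes> s p [^] i"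
          unfolding \<Psi>_expansion[OF a]
          by (rule UP.coeff_finsum_monom) (use y True p_pos in auto)
        then show ?thesis unfolding k using y by (simp add: fy m_comm)
      next
        case False
        have "cf (\<Psi> ?X) n = \<zero>"
          unfolding \<Psi>_expansion[OF a]
          by (rule UP.coeff_finsum_monom_0) (use y False k p_pos in auto)
        moreover have "deg R f < n"
        proof -
          have "k \<le> p * k" using p_pos by simp
          then show ?thesis using False k by linarith
        qed
        then have "cf f n = \<zero>" using f by (intro UP.deg_aboveD)
        ultimately show ?thesis by simp
      qed
    qed
  qed (rule f)
  then show ?thesis using X by (intro image_eqI) (rule sym)
qed

end

section \<open>The comparison with the divisible subcomplex\<close>

theorem proposition4p2p6:
  fixes R :: "('a, 'r) ring_scheme" (structure)
    and s :: "nat \<Rightarrow> 'a" and \<phi> :: "'a \<Rightarrow> 'a" and p :: nat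
  assumes "cring R"
    and "Factorial_Ring.prime p"
    and "generalized_n_series R s"
    and "\<phi> \<in> ring_hom R R"
    and "\<And>n. s p \<otimes> \<phi> (s n) = s (n * p)"
    and "(PIdl (s p)) +> s 1 \<in> Units (R Quot (PIdl (s p)))"
    and "adically_complete R (s p)"
  shows "semilinear_cochain_map R R \<phi> (s_deRham R s) (s_deRham R s) (Phi R s \<phi> p) \<and>
    (\<exists>\<Psi>. (\<forall>i. \<forall>\<omega>\<in>carrier (obj (s_deRham R s) i).
             Phi R s \<phi> p i \<omega> = \<Psi> i (pure_tensor R R \<phi> (obj (s_deRham R s) i) \<one> \<omega>)) \<and>
          quasi_isomorphism R (base_change R R \<phi> (s_deRham R s)) (eta R (s p) (s_deRham R s)) \<Psi>)"
proof -
  interpret frobenius_n_series R s \<phi> p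
    using assms(1-5) prime_gt_0_nat
    by (intro frobenius_n_series.intro n_series_cring.intro n_series_cring_axioms.intro
        frobenius_n_series_axioms.intro) auto
  let ?C = "s_deRham R s" and ?E = "eta R (s p) (s_deRham R s)"
  interpret C: complex_over R ?C by (rule complex_over.intro[OF s_deRham_complex])
  obtain \<Psi> where \<Psi>: "cochain_map R (base_change R R \<phi> ?C) ?E \<Psi>"
    and \<Psi>_pure: "\<And>i a g. a \<in> carrier R \<Longrightarrow> g \<in> carrier (obj ?C i) \<Longrightarrow>
      \<Psi> i (pure_tensor R R \<phi> (obj ?C i) a g) = a \<odot>\<^bsub>obj ?E i\<^esub> Phi R s \<phi> p i g"
    using semilinear_cochain_map_lift[OF assms(1,4) Phi_cochain_map_eta] by metis
  have E_C: "z \<in> carrier (obj ?C i)" if "z \<in> carrier (obj ?E i)" for z i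
    using C.carrier_eta_subset[OF s_closed that] .
  have \<Psi>_linear: "semilinear_map R (\<lambda>r. r) (base_change_module R R \<phi> (obj ?C i)) (obj ?E i) (\<Psi> i)" for i
    using \<Psi> unfolding semilinear_cochain_map_def by simp
  have lin: "linearised_Phi R s \<phi> p i (\<Psi> i)" if i: "i \<le> 1" for i
  proof (intro linearised_Phi.intro linearised_Phi_axioms.intro frobenius_n_series_axioms i)
    show "semilinear_map R (\<lambda>r. r) T (UP R) (\<Psi> i)"
      using \<Psi>_linear[of i] E_C[of _ i] i unfolding semilinear_map_def
      by (auto simp: obj_s_deRham)
    show "\<Psi> i (pt a g) = a \<odot>\<^bsub>UP R\<^esub> Phi R s \<phi> p i g" if "a \<in> carrier R" "g \<in> carrier (UP R)" for a g
      using \<Psi>_pure[of a g i] that i by (simp add: obj_s_deRham)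
  qed
  interpret L0: linearised_Phi R s \<phi> p 0 "\<Psi> 0" by (rule lin) simp
  interpret L1: linearised_Phi R s \<phi> p 1 "\<Psi> 1" by (rule lin) simp
  have ext_C: "scalar_extension R R (obj ?C i) \<phi>" for i
    by (intro scalar_extension.intro scalar_extension_axioms.intro assms(1,4) C.obj.module_axioms)
  interpret E: complex_over R ?E by (rule complex_over.intro[OF C.eta_complex[OF s_closed]])
  have "quasi_isomorphism R (base_change R R \<phi> ?C) ?E \<Psi>"
  proof (rule quasi_isomorphismI[OF \<Psi>])
    fix i X
    assume X: "X \<in> carrier (obj (base_change R R \<phi> ?C) i)" "\<Psi> i X = \<zero>\<^bsub>obj ?E i\<^esub>"
    \<comment> \<open>Beyond degree 1 the base change of the zero module is zero.\<close>
    show "X = \<zero>\<^bsub>obj (base_change R R \<phi> ?C) i\<^esub>"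
    proof (cases "i \<le> 1")
      case True
      then show ?thesis
        using linearised_Phi.\<Psi>_injective[OF lin, of i X] X by (simp add: obj_s_deRham)
    next
      case False
      interpret T: scalar_extension R R "obj ?C i" \<phi> by (rule ext_C)
      have "X \<in> carrier T.T" using X(1) by simp
      then have "X = \<zero>\<^bsub>T.T\<^esub>"
      proof (induction rule: T.tensor_induct)
        case (pure a g)
        then have "g = \<zero>\<^bsub>obj ?C i\<^esub>" using False by (simp add: obj_s_deRham)
        then show ?case using pure(1) T.pure_zero_right by simp
      qed simp
      then show ?thesis by simp
    qed
  next
    fix i z
    assume z: "z \<in> carrier (obj ?E i)"
      and dz: "diff ?E i z \<in> \<Psi> (Suc i) ` carrier (obj (base_change R R \<phi> ?C) (Suc i))"
    show "\<exists>c\<in>carrier (obj (base_change R R \<phi> ?C) i). \<exists>b\<in>coboundaries ?E i. z = \<Psi> i c \<oplus>\<^bsub>obj ?E i\<^esub> b"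
    proof -
      consider "i = 0" | "i = 1" | "i > 1" by linarith
      then show ?thesis
      proof cases
        case 1
        then have zP: "z \<in> carrier (UP R)" using E_C[OF z] by (simp add: obj_s_deRham)
        \<comment> \<open>In degree 0: if \<open>\<nabla>z\<close> lies in weights divisible by \<open>p\<close>, then so does \<open>z\<close>, as \<open>s(n)\<close> is not a zero
          divisor for the other weights \<open>n\<close>, all of them positive.\<close>
        have "cf z n = \<zero>" if n: "\<not> p dvd n + 0" for n
        proof (cases n)
          case 0
          then show ?thesis using n by simp
        next
          case (Suc m)
          have "cf (nabla R s z) m = \<zero>"
            using dz 1 n Suc L1.coeff_\<Psi>_0[of _ m] by (auto simp: diff_s_deRham obj_s_deRham)
          then show ?thesis
            using s_cancel[of n "cf z n"] zP Suc by (simp add: coeff_nabla)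
        qed
        then have "z \<in> \<Psi> 0 ` carrier T"
          by (intro L0.mem_image_\<Psi>[OF zP zP]) (simp_all add: zP)
        then obtain c where c: "c \<in> carrier T" "z = \<Psi> 0 c" by blast
        then have "z = \<Psi> 0 c \<oplus>\<^bsub>obj ?E 0\<^esub> \<zero>\<^bsub>obj ?E 0\<^esub>" using zP by (simp add: obj_s_deRham)
        moreover have "c \<in> carrier (obj (base_change R R \<phi> ?C) 0)" using c(1) by (simp add: obj_s_deRham)
        moreover have "\<zero>\<^bsub>obj ?E 0\<^esub> \<in> coboundaries ?E 0" by simp
        ultimately show ?thesis unfolding 1 by (intro bexI)
      next
        case 2
        obtain y where y: "y \<in> carrier (UP R)" "z = s p \<odot>\<^bsub>UP R\<^esub> y"
          using z 2 by (auto simp: carrier_obj_eta obj_s_deRham)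
        have unit: "s m \<in> Units R" if "\<not> p dvd m" for m
          by (rule s_Units_of_coprime[OF assms(2) that assms(6,7)])
        \<comment> \<open>In degree 1, \<open>z = s(p) y\<close>. The part \<open>w\<close> of \<open>y\<close> in weights divisible by \<open>p\<close> gives an element of the
          image of \<open>\<Psi>\<close>; the rest is integrated to \<open>v\<close> by dividing by the units \<open>s(m)\<close>.\<close>
        define c where "c n = (if p dvd n + 1 then cf y n else \<zero>)" for n
        define h where "h m = (if p dvd m then \<zero> else inv (s m) \<otimes> (s p \<otimes> cf y (m - 1)))" for m
        have big: "cf y n = \<zero>" if "n > deg R y" for n
          using that y(1) by (intro UP.deg_aboveD)
        obtain w where w: "w \<in> carrier (UP R)" "\<And>n. cf w n = c n"
        proof (rule UP.polynomial_of_coeffs)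
          show "c n \<in> carrier R" for n using y(1) by (simp add: c_def)
          show "c n = \<zero>" if "n > deg R y" for n using big[OF that] by (simp add: c_def)
        qed (rule that)
        obtain v where v: "v \<in> carrier (UP R)" "\<And>n. cf v n = h n"
        proof (rule UP.polynomial_of_coeffs)
          show "h n \<in> carrier R" for n using y(1) unit[of n] by (simp add: h_def)
          show "h n = \<zero>" if "n > Suc (deg R y)" for n
            using big[of "n - 1"] that unit[of n] by (simp add: h_def)
        qed (rule that)
        have nabla_v: "nabla R s v = s p \<odot>\<^bsub>UP R\<^esub> (y \<ominus>\<^bsub>UP R\<^esub> w)"
        proof (rule UP.up_eqI)
          fix n
          show "cf (nabla R s v) n = cf (s p \<odot>\<^bsub>UP R\<^esub> (y \<ominus>\<^bsub>UP R\<^esub> w)) n"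
          proof (cases "p dvd n + 1")
            case True
            then show ?thesis
              using y(1) v w by (simp add: coeff_nabla h_def c_def r_neg UP.coeff_minus a_minus_def)
          next
            case False
            then have "s (Suc n) \<otimes> (inv (s (Suc n)) \<otimes> (s p \<otimes> cf y n)) = s p \<otimes> cf y n"
              using unit[of "Suc n"] y(1) by (simp add: m_assoc[symmetric] Units_r_inv)
            then show ?thesis
              using y(1) v w False by (simp add: coeff_nabla h_def c_def a_minus_def)
          qed
        qed (use v w y in \<open>auto intro: nabla_closed\<close>)
        \<comment> \<open>The factor \<open>s(p)\<close> in \<open>\<nabla>v\<close> is what membership in degree 0 of \<open>\<eta>\<close> demands.\<close>
        have vE: "v \<in> carrier (obj ?E 0)"
          using v(1) nabla_v y(1) w(1)
          by (auto simp: carrier_obj_eta obj_s_deRham diff_s_deRham intro!: bexI[of _ "y \<ominus>\<^bsub>UP R\<^esub> w"])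
        have "s p \<odot>\<^bsub>UP R\<^esub> w \<in> \<Psi> 1 ` carrier T"
        proof (rule L1.mem_image_\<Psi>[OF _ w(1)])
          show "cf (s p \<odot>\<^bsub>UP R\<^esub> w) n = \<zero>" if "\<not> p dvd n + 1" for n
            using that w by (simp add: c_def)
        qed (use w(1) in simp_all)
        then obtain X where X: "X \<in> carrier T" "s p \<odot>\<^bsub>UP R\<^esub> w = \<Psi> 1 X" by blast
        have "w \<oplus>\<^bsub>UP R\<^esub> (y \<ominus>\<^bsub>UP R\<^esub> w) = y"
          using y(1) w(1) by (simp add: a_minus_def UP.P.a_lcomm[of w y] UP.P.r_neg)
        then have "z = s p \<odot>\<^bsub>UP R\<^esub> w \<oplus>\<^bsub>UP R\<^esub> s p \<odot>\<^bsub>UP R\<^esub> (y \<ominus>\<^bsub>UP R\<^esub> w)"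
          unfolding y(2) using y(1) w(1)
          by (simp add: UP.UP_smult_r_distr[symmetric])
        then have "z = \<Psi> 1 X \<oplus>\<^bsub>obj ?E 1\<^esub> nabla R s v"
          using X(2) nabla_v by (simp add: obj_s_deRham)
        moreover have "nabla R s v \<in> coboundaries ?E 1"
          using vE by (simp add: diff_s_deRham)
        moreover have "X \<in> carrier (obj (base_change R R \<phi> ?C) 1)" using X(1) by (simp add: obj_s_deRham)
        ultimately show ?thesis unfolding 2 by (intro bexI)
      next
        case 3
        then have z0: "z = \<zero>\<^bsub>obj ?E i\<^esub>" using E_C[OF z] by (simp add: obj_s_deRham)
        interpret T: scalar_extension R R "obj ?C i" \<phi> by (rule ext_C)
        interpret \<Psi>: abelian_group_hom T.T "obj ?E i" "\<Psi> i"
          by (rule semilinear_map_hom[OF \<Psi>_linear T.tensor_abelian_group E.obj.abelian_group_axioms])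
        interpret B: abelian_subgroup "coboundaries ?E i" "obj ?E i" by (rule E.coboundaries_subgroup)
        have "z = \<Psi> i \<zero>\<^bsub>T.T\<^esub> \<oplus>\<^bsub>obj ?E i\<^esub> \<zero>\<^bsub>obj ?E i\<^esub>" using z0 \<Psi>.hom_zero E.obj.l_zero by simp
        then show ?thesis
          unfolding obj_base_change by (rule bexI[OF bexI[OF _ B.zero_closed] T.T.zero_closed])
      qed
    qed
  qed
  moreover have "Phi R s \<phi> p i \<omega> = \<Psi> i (pure_tensor R R \<phi> (obj ?C i) \<one> \<omega>)"
    if "\<omega> \<in> carrier (obj ?C i)" for i \<omega>
  proof -
    have "Phi R s \<phi> p i \<omega> \<in> carrier (obj ?C i)"
      using Phi_cochain_map that unfolding semilinear_cochain_map_def semilinear_map_def by blast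
    then show ?thesis using \<Psi>_pure[of \<one> \<omega> i] that by simp
  qed
  ultimately show ?thesis using Phi_cochain_map by blast
qed

end
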